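(* Let $\mathbb{F}$ be $\mathbb{R}$ or $\mathbb{C}$, let $1\le m\le k-1$, and let $\{\mathcal{W}_i\}_{i=1}^n\subset Gr(\mathbb{F},k,m)$. Then the following statements about the collection of orthogonal complements $\{\mathcal{W}_i^\perp\}_{i=1}^n\subset Gr(\mathbb{F},k,k-m)$ hold. 1. $\{\mathcal{W}_i\}_{i=1}^n$ is a tight fusion frame with bound $A$ if and only if $\{\mathcal{W}_i^\perp\}_{i=1}^n$ is a tight fusion frame with bound $n-A$. 2. $\{\mathcal{W}_i\}_{i=1}^n$ is equichordal (not necessarily a fusion frame) if and only if $\{\mathcal{W}_i^\perp\}_{i=1}^n$ is. 3. $\{\mathcal{W}_i\}_{i=1}^n$ is strongly simplicial (not necessarily a fusion frame) if and only if $\{\mathcal{W}_i^\perp\}_{i=1}^n$ is. 4. If $\{\mathcal{W}_i\}_{i=1}^n$ is equiisoclinic (not necessarily a fusion frame), then $\{\mathcal{W}_i^\perp\}_{i=1}^n$ is equiisoclinic (not necessarily a fusion frame) if and only if $k=2m$ or the subspaces $\mathcal{W}_i$ are all the same. 5. $\{\mathcal{W}_i\}_{i=1}^n$ is an orthoplectic Grassmannian packing if and only if $\{\mathcal{W}_i^\perp\}_{i=1}^n$ is.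
   Context: Notation: $[n]=\{1,\dots,n\}$; $A^\ast$ is the conjugate transpose of $A$; $Gr(\mathbb{F},k,m)$ is the collection of $m$-dimensional subspaces of $\mathbb{F}^k$, for $1\le m\le k-1$. The following definitions apply to a collection $\{\mathcal{W}_i\}_{i=1}^n\subset Gr(\mathbb{F},k,m)$ (for $\{\mathcal{W}_i^\perp\}$ replace $m$ by $k-m$). Let $P_i$ be the orthogonal projection onto $\mathcal{W}_i$, and let $L_i$ be a $k\times m$ matrix whose columns form an orthonormal basis of $\mathcal{W}_i$ (so $P_i=L_iL_i^\ast$). - The chordal distance is $d_c(\mathcal{W}_i,\mathcal{W}_j)=[m-\operatorname{tr}(P_iP_j)]^{1/2}$. - Equichordal: $\operatorname{tr}(L_i^\ast L_jL_j^\ast L_i)$ is the same constant for all $i\ne j$ in $[n]$. - Strongly simplicial: $L_i^\ast L_jL_j^\ast L_i$ has the same eigenvalues (counted with multiplicity) for all $i\neq j$ in $[n]$. - Equiisoclinic: there is $\alpha\ge 0$ such that $L_i^\ast L_jL_j^\ast L_i=\alpha I_m$ for all $i\ne j$ in $[n]$. - Tight fusion frame (with unit weights) with (fusion frame) bound $A$: $A>0$ and $x=\frac1A\sum_{i=1}^nP_ix$ for all $x\in\mathbb{F}^k$. - Let $\mathcal{Z}(\mathbb{C},k)=k^2$ and $\mathcal{Z}(\mathbb{R},k)=\frac{k(k+1)}2$. The collection is an orthoplectic Grassmannian packing if $\mathcal{Z}(\mathbb{F},k)<n\le 2(\mathcal{Z}(\mathbb{F},k)-1)$ and it saturates the orthoplex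 bound, i.e. $\min_{i,j\in[n],\,i\ne j}d_c^2(\mathcal{W}_i,\mathcal{W}_j)=\frac{m(k-m)}{k}$. *)

theory Defs
  imports
    Complex_Main
    "Jordan_Normal_Form.VS_Connect"
    "Jordan_Normal_Form.Schur_Decomposition"
    "Jordan_Normal_Form.Char_Poly"
begin

text \<open>
  The definitions below are generic in the scalar type; the class only collects what they need
  from the field and is meant to have exactly the two instances \<^typ>\<open>real\<close> and \<^typ>\<open>complex\<close>.
  The number \<open>hermitian_dim TYPE('a) k\<close> is the quantity written Z(F,k) in the literature (the real
  dimension of the space of self-adjoint k by k matrices over F).
\<close>

class real_or_complex = conjugatable_ordered_field + real_algebra_1 +
  fixes real_part :: "'a \<Rightarrow> real"
    and hermitian_dim :: "'a itself \<Rightarrow> nat \<Rightarrow> nat"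

instantiation real :: real_or_complex
begin
definition real_part_real :: "real \<Rightarrow> real" where
  "real_part_real x = x"
definition hermitian_dim_real :: "real itself \<Rightarrow> nat \<Rightarrow> nat" where
  "hermitian_dim_real _ k = k * (k + 1) div 2"
instance ..
end

instantiation complex :: real_or_complex
begin
definition real_part_complex :: "complex \<Rightarrow> real" where
  "real_part_complex z = Re z"
definition hermitian_dim_complex :: "complex itself \<Rightarrow> nat \<Rightarrow> nat" where
  "hermitian_dim_complex _ k = k\<^sup>2"
instance ..
end

definition Gr :: "nat \<Rightarrow> nat \<Rightarrow> 'a::field vec set set" where
  "Gr k m = {W. VectorSpace.subspace class_ring W (module_vec TYPE('a) k) \<and>
      vectorspace.dim class_ring (module_vec TYPE('a) k \<lparr>carrier := W\<rparr>) = m}"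

text \<open>
  The library's \<open>vec_space.orthogonal_complement\<close> is taken with respect to the bilinear form
  \<open>x \<bullet> y\<close>, which is the wrong notion over the complex numbers.
\<close>

definition orth_compl :: "nat \<Rightarrow> 'a::conjugatable_field vec set \<Rightarrow> 'a vec set" where
  "orth_compl k W = {x \<in> carrier_vec k. \<forall>w\<in>W. x \<bullet>c w = 0}"

definition orth_proj :: "nat \<Rightarrow> 'a::conjugatable_field vec set \<Rightarrow> 'a mat" where
  "orth_proj k W = (THE P. P \<in> carrier_mat k k \<and>
      (\<forall>x\<in>carrier_vec k. P *\<^sub>v x \<in> W \<and> x - P *\<^sub>v x \<in> orth_compl k W))"

definition is_onb_mat :: "nat \<Rightarrow> nat \<Rightarrow> 'a::conjugatable_field vec set \<Rightarrow> 'a mat \<Rightarrow> bool" where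
  "is_onb_mat k m W L \<longleftrightarrow> L \<in> carrier_mat k m \<and>
      (\<forall>i<m. \<forall>j<m. col L i \<bullet>c col L j = (if i = j then 1 else 0)) \<and>
      LinearCombinations.module.span class_ring (module_vec TYPE('a) k) (set (cols L)) = W"

text \<open>
  An arbitrary choice of orthonormal basis: another choice replaces \<open>L\<close> by \<open>L * U\<close> with \<open>U\<close> unitary,
  so none of the notions below depends on it.
\<close>

definition onb_mat :: "nat \<Rightarrow> nat \<Rightarrow> 'a::conjugatable_field vec set \<Rightarrow> 'a mat" where
  "onb_mat k m W = (SOME L. is_onb_mat k m W L)"

definition mat_trace :: "'a::comm_monoid_add mat \<Rightarrow> 'a" where
  "mat_trace A = (\<Sum>i<dim_row A. A $$ (i, i))"

definition cross_gram :: "nat \<Rightarrow> nat \<Rightarrow> 'a::conjugatable_field vec set \<Rightarrow> 'a vec set \<Rightarrow> 'a mat" where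
  "cross_gram k m W W' =
     (let L = onb_mat k m W; L' = onb_mat k m W'
      in mat_adjoint L * L' * mat_adjoint L' * L)"

text \<open>The trace of a product of two orthogonal projections is real, so \<open>real_part\<close> loses nothing.\<close>

definition chordal_dist :: "nat \<Rightarrow> nat \<Rightarrow> 'a::real_or_complex vec set \<Rightarrow> 'a vec set \<Rightarrow> real" where
  "chordal_dist k m W W' =
     sqrt (real m - real_part (mat_trace (orth_proj k W * orth_proj k W')))"

definition equichordal :: "nat \<Rightarrow> nat \<Rightarrow> nat \<Rightarrow> (nat \<Rightarrow> 'a::conjugatable_field vec set) \<Rightarrow> bool" where
  "equichordal k m n W \<longleftrightarrow>
     (\<exists>c. \<forall>i\<in>{1..n}. \<forall>j\<in>{1..n}. i \<noteq> j \<longrightarrow> mat_trace (cross_gram k m (W i) (W j)) = c)"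

text \<open>
  The matrices \<open>cross_gram k m (W i) (W j)\<close> are self-adjoint, so also over the reals the roots of
  the characteristic polynomial in the base field are all of the eigenvalues.
\<close>

definition strongly_simplicial ::
    "nat \<Rightarrow> nat \<Rightarrow> nat \<Rightarrow> (nat \<Rightarrow> 'a::conjugatable_field vec set) \<Rightarrow> bool" where
  "strongly_simplicial k m n W \<longleftrightarrow>
     (\<exists>E. \<forall>i\<in>{1..n}. \<forall>j\<in>{1..n}. i \<noteq> j \<longrightarrow>
        proots (char_poly (cross_gram k m (W i) (W j))) = E)"

definition equiisoclinic ::
    "nat \<Rightarrow> nat \<Rightarrow> nat \<Rightarrow> (nat \<Rightarrow> 'a::real_or_complex vec set) \<Rightarrow> bool" where
  "equiisoclinic k m n W \<longleftrightarrow>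
     (\<exists>\<alpha>::real. \<alpha> \<ge> 0 \<and> (\<forall>i\<in>{1..n}. \<forall>j\<in>{1..n}. i \<noteq> j \<longrightarrow>
        cross_gram k m (W i) (W j) = of_real \<alpha> \<cdot>\<^sub>m 1\<^sub>m m))"

definition tight_fusion_frame ::
    "nat \<Rightarrow> nat \<Rightarrow> real \<Rightarrow> (nat \<Rightarrow> 'a::real_or_complex vec set) \<Rightarrow> bool" where
  "tight_fusion_frame k n A W \<longleftrightarrow> A > 0 \<and>
     (\<forall>x\<in>carrier_vec k.
        x = of_real (1 / A) \<cdot>\<^sub>v finsum_vec TYPE('a) k (\<lambda>i. orth_proj k (W i) *\<^sub>v x) {1..n})"

definition orthoplectic_packing ::
    "nat \<Rightarrow> nat \<Rightarrow> nat \<Rightarrow> (nat \<Rightarrow> 'a::real_or_complex vec set) \<Rightarrow> bool" where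
  "orthoplectic_packing k m n W \<longleftrightarrow>
     hermitian_dim TYPE('a) k < n \<and> n \<le> 2 * (hermitian_dim TYPE('a) k - 1) \<and>
     Min {(chordal_dist k m (W i) (W j))\<^sup>2 | i j. i \<in> {1..n} \<and> j \<in> {1..n} \<and> i \<noteq> j}
       = real m * real (k - m) / real k"

end

theory Submission
  imports Defs
begin

text \<open>
  Fix two subspaces \<open>W\<close> and \<open>W'\<close> of dimension \<open>m\<close>, choose matrices \<open>L\<close>, \<open>L'\<close> of orthonormal bases of
  them and matrices \<open>M\<close>, \<open>M'\<close> of orthonormal bases of their orthogonal complements, and put \<open>B = L\<^sup>* M'\<close>,
  an \<open>m\<close> by \<open>k - m\<close> matrix. Since \<open>L' L'\<^sup>* + M' M'\<^sup>* = 1\<close> and likewise for \<open>L\<close>, \<open>M\<close>,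

  \<open>L\<^sup>* L' L'\<^sup>* L = 1 - B B\<^sup>*\<close>  and  \<open>M'\<^sup>* M M\<^sup>* M' = 1 - B\<^sup>* B\<close>

  (lemma \<open>cross_gram_complement\<close>). The left-hand sides are the cross-Gramians of the pair
  and of the swapped pair of complements, so three of the equivalences reduce to comparing \<open>B B\<^sup>*\<close>
  with \<open>B\<^sup>* B\<close>. Equal traces settle the equichordal case. The products share their nonzero eigenvalues,
  so the two cross-Gramians have the same eigenvalues up to a fixed number of eigenvalues equal to 1
  (\<open>char_poly_one_minus_mult_comm\<close>), which settles the strongly simplicial case. For the
  equiisoclinic case, \<open>B B\<^sup>*\<close> and \<open>B\<^sup>* B\<close> can both be scalar only if
  \<open>B = 0\<close> or \<open>B\<close> is square (\<open>scalar_grams_imp_zero_or_square\<close>); the former means \<open>W \<subseteq> W'\<close>, the latter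
  \<open>k = 2 m\<close>. Conversely, if \<open>B B\<^sup>*\<close> is scalar, then each of these conditions makes \<open>B\<^sup>* B\<close> scalar.

  The remaining two cases use the projections. With \<open>P\<close> the projection onto \<open>W\<close>, the projection onto
  the complement is \<open>1 - P\<close>. Hence chordal distances do not change at all (\<open>chordal_dist_orth_compl\<close>), and
  the frame operators of the two collections add up to \<open>n\<close> times the identity
  (\<open>tight_fusion_frame_complement\<close>).

  The real and the complex case are treated together, over a class of scalars that provides the
  square roots needed for orthonormal bases and a real part compatible with real translations.
\<close>

section \<open>Traces and characteristic polynomials\<close>

lemma mat_trace_mult_comm:
  fixes A :: "'a::comm_semiring_0 mat"
  assumes "A \<in> carrier_mat m d" "B \<in> carrier_mat d m"
  shows "mat_trace (A * B) = mat_trace (B * A)"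
proof -
  have "mat_trace (A * B) = (\<Sum>i<m. \<Sum>j<d. A $$ (i, j) * B $$ (j, i))"
    using assms by (auto simp: mat_trace_def scalar_prod_def atLeast0LessThan intro!: sum.cong)
  also have "\<dots> = (\<Sum>j<d. \<Sum>i<m. B $$ (j, i) * A $$ (i, j))"
    by (subst sum.swap) (simp add: mult.commute)
  also have "\<dots> = mat_trace (B * A)"
    using assms by (auto simp: mat_trace_def scalar_prod_def atLeast0LessThan intro!: sum.cong)
  finally show ?thesis .
qed

lemma mat_trace_add:
  assumes "A \<in> carrier_mat m m" "B \<in> carrier_mat m m"
  shows "mat_trace (A + B) = mat_trace A + mat_trace B"
  using assms by (simp add: mat_trace_def sum.distrib)

lemma mat_trace_minus:
  fixes A :: "'a::ab_group_add mat"
  assumes "A \<in> carrier_mat m m" "B \<in> carrier_mat m m"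
  shows "mat_trace (A - B) = mat_trace A - mat_trace B"
  using assms by (simp add: mat_trace_def sum_subtractf)

lemma mat_trace_one: "mat_trace (1\<^sub>m m :: 'a::semiring_1 mat) = of_nat m"
  by (simp add: mat_trace_def)

lemma mat_trace_smult:
  fixes A :: "'a::semiring_0 mat"
  assumes "A \<in> carrier_mat m m"
  shows "mat_trace (a \<cdot>\<^sub>m A) = a * mat_trace A"
  using assms by (simp add: mat_trace_def sum_distrib_left)

lemma char_poly_four_block_upper_right_zero:
  fixes A :: "'a::idom mat"
  assumes A: "A \<in> carrier_mat m m" and C: "C \<in> carrier_mat d m" and D: "D \<in> carrier_mat d d"
  shows "char_poly (four_block_mat A (0\<^sub>m m d) C D) = char_poly A * char_poly D"
proof -
  let ?cm = "\<lambda>A. [:0, 1:] \<cdot>\<^sub>m 1\<^sub>m (dim_row A) + map_mat (\<lambda>a. [:- a:]) A"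
  have "?cm (four_block_mat A (0\<^sub>m m d) C D)
      = four_block_mat (?cm A) (0\<^sub>m m d) (map_mat (\<lambda>a. [:- a:]) C) (?cm D)"
    by (rule eq_matI, insert A C D, auto simp: one_poly_def)
  moreover have "det \<dots> = det (?cm A) * det (?cm D)"
    by (rule det_four_block_mat_upper_right_zero[of _ m _ d], insert A C D, auto)
  ultimately show ?thesis unfolding char_poly_defs by simp
qed

lemma char_poly_one: "char_poly (1\<^sub>m m :: 'a::idom mat) = [:- 1, 1:] ^ m"
proof -
  have "char_poly (1\<^sub>m m :: 'a mat) = (\<Prod>a\<leftarrow>diag_mat (1\<^sub>m m :: 'a mat). [:- a, 1:])"
    by (rule char_poly_upper_triangular[of _ m]) auto
  also have "diag_mat (1\<^sub>m m :: 'a mat) = replicate m 1"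
    by (rule nth_equalityI) (auto simp: diag_mat_def)
  finally show ?thesis by simp
qed

text \<open>
  Sylvester's identity, shifted by the identity matrix: \<open>B * C\<close> and \<open>C * B\<close> have the same nonzero
  eigenvalues, so \<open>1 - B * C\<close> and \<open>1 - C * B\<close> differ only in the multiplicity of the eigenvalue 1.
  Completing the two blocks to square matrices of size \<open>m + d\<close> by an identity block and the common
  off-diagonal block \<open>- C\<close> gives similar matrices, which are conjugate under the unipotent
  block matrix with upper right entry \<open>B\<close>.
\<close>

lemma char_poly_one_minus_mult_comm:
  fixes B :: "'a::idom mat"
  assumes B: "B \<in> carrier_mat m d" and C: "C \<in> carrier_mat d m"
  shows "char_poly (1\<^sub>m m - B * C) * [:- 1, 1:] ^ d = [:- 1, 1:] ^ m * char_poly (1\<^sub>m d - C * B)"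
proof -
  define E where "E = B * C"
  define F where "F = C * B"
  define X where "X = four_block_mat (1\<^sub>m m - E) (0\<^sub>m m d) (- C) (1\<^sub>m d)"
  define Y where "Y = four_block_mat (1\<^sub>m m) (0\<^sub>m m d) (- C) (1\<^sub>m d - F)"
  define T where "T = four_block_mat (1\<^sub>m m) B (0\<^sub>m d m) (1\<^sub>m d)"
  define S where "S = four_block_mat (1\<^sub>m m) (- B) (0\<^sub>m d m) (1\<^sub>m d)"
  have E: "E \<in> carrier_mat m m" and F: "F \<in> carrier_mat d d"
    unfolding E_def F_def using mult_carrier_mat[OF B C] mult_carrier_mat[OF C B] .
  have mE: "1\<^sub>m m - E \<in> carrier_mat m m" and mF: "1\<^sub>m d - F \<in> carrier_mat d d"
    using E F by (auto intro: minus_carrier_mat)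
  have EB: "E * B = B * F" unfolding E_def F_def by (rule assoc_mult_mat[OF B C B])
  note carr = B C E F mE mF uminus_carrier_mat[OF B] uminus_carrier_mat[OF C]
    mult_carrier_mat[OF E B] mult_carrier_mat[OF B F]
  have BC: "B * - C = - E" "C * - B = - F" "- C * - B = F"
    using B C unfolding E_def F_def
    by (intro eq_matI; simp add: scalar_prod_def sum_negf)+
  have XYTS: "{X, Y, T, S} \<subseteq> carrier_mat (m + d) (m + d)"
    using carr by (auto simp: X_def Y_def T_def S_def intro!: four_block_carrier_mat)
  have TS: "T * S = 1\<^sub>m (m + d)"
    unfolding T_def S_def using carr
    by (subst mult_four_block_mat[of _ m m _ d _ d _ _ m _ d])
       (auto simp flip: four_block_one_mat intro!: cong_four_block_mat eq_matI)
  have ST: "S * T = 1\<^sub>m (m + d)"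
    unfolding T_def S_def using carr
    by (subst mult_four_block_mat[of _ m m _ d _ d _ _ m _ d])
       (auto simp flip: four_block_one_mat intro!: cong_four_block_mat eq_matI)
  have TY: "T * Y = four_block_mat (1\<^sub>m m - E) (B - B * F) (- C) (1\<^sub>m d - F)"
    unfolding T_def Y_def using carr
    by (subst mult_four_block_mat[of _ m m _ d _ d _ _ m _ d])
       (auto simp: BC mult_minus_distrib_mat[OF B one_carrier_mat F] intro!: cong_four_block_mat eq_matI)
  have "(1\<^sub>m m - E) * - B + (B - B * F) = 0\<^sub>m m d"
    using carr by (auto simp: minus_mult_distrib_mat[OF one_carrier_mat E] EB intro!: eq_matI)
  moreover have "- C * - B + (1\<^sub>m d - F) = 1\<^sub>m d"
    unfolding BC using carr by (auto intro!: eq_matI)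
  ultimately have "T * Y * S = X"
    unfolding TY S_def X_def using carr
    by (subst mult_four_block_mat[of _ m m _ d _ d _ _ m _ d])
       (auto simp: minus_carrier_mat intro!: cong_four_block_mat)
  then have "similar_mat X Y"
    using XYTS TS ST by (intro similar_matI[of _ _ T S]) auto
  then have "char_poly X = char_poly Y" by (rule char_poly_similar)
  then show ?thesis
    unfolding X_def Y_def E_def[symmetric] F_def[symmetric] using carr
    by (simp add: char_poly_four_block_upper_right_zero char_poly_one)
qed

section \<open>Conjugate transposes\<close>

lemma mat_adjoint_carrier: "A \<in> carrier_mat m d \<Longrightarrow> mat_adjoint A \<in> carrier_mat d m"
  by (auto simp: mat_adjoint_def)

lemma dim_mat_adjoint [simp]: "dim_row (mat_adjoint A) = dim_col A" "dim_col (mat_adjoint A) = dim_row A"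
  by (auto simp: mat_adjoint_def)

lemma index_mat_adjoint [simp]:
  "i < dim_col A \<Longrightarrow> j < dim_row A \<Longrightarrow> mat_adjoint A $$ (i, j) = conjugate (A $$ (j, i))"
  by (auto simp: mat_adjoint_def mat_of_rows_index)

lemma mat_adjoint_adjoint [simp]: "mat_adjoint (mat_adjoint A) = A"
  by (rule eq_matI) auto

lemma mat_adjoint_mult:
  fixes A :: "'a::conjugatable_field mat"
  assumes "A \<in> carrier_mat m d" "B \<in> carrier_mat d p"
  shows "mat_adjoint (A * B) = mat_adjoint B * mat_adjoint A"
  using assms
  by (intro eq_matI)
     (auto simp: scalar_prod_def sum_conjugate conjugate_dist_mul mult.commute intro!: sum.cong)

lemma conjugate_one [simp]: "conjugate (1 :: 'a::conjugatable_field) = 1"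
proof -
  have "conjugate (1 :: 'a) * conjugate 1 = conjugate 1 * 1"
    using conjugate_dist_mul[of "1 :: 'a" 1] by simp
  then show ?thesis by (subst (asm) mult_cancel_left) simp
qed

lemma cscalar_prod_mult_mat_vec:
  fixes A :: "'a::conjugatable_field mat"
  assumes A: "A \<in> carrier_mat m d" and x: "x \<in> carrier_vec m" and y: "y \<in> carrier_vec d"
  shows "x \<bullet>c (A *\<^sub>v y) = (mat_adjoint A *\<^sub>v x) \<bullet>c y"
proof -
  have "x \<bullet>c (A *\<^sub>v y) = (\<Sum>i<m. \<Sum>j<d. x $ i * conjugate (A $$ (i, j)) * conjugate (y $ j))"
    using assms by (auto simp: scalar_prod_def atLeast0LessThan sum_conjugate conjugate_dist_mul
        sum_distrib_left mult.assoc intro!: sum.cong)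
  also have "\<dots> = (\<Sum>j<d. \<Sum>i<m. x $ i * conjugate (A $$ (i, j)) * conjugate (y $ j))"
    by (rule sum.swap)
  also have "\<dots> = (mat_adjoint A *\<^sub>v x) \<bullet>c y"
    using assms by (auto simp: scalar_prod_def atLeast0LessThan sum_distrib_right sum_distrib_left mult_ac intro!: sum.cong)
  finally show ?thesis .
qed

text \<open>
  The diagonal entries of \<open>B * mat_adjoint B\<close> are the squared norms of the rows of \<open>B\<close>.
\<close>

lemma mult_adjoint_eq_0_iff:
  fixes B :: "'a::conjugatable_ordered_field mat"
  assumes B: "B \<in> carrier_mat m d"
  shows "B * mat_adjoint B = 0\<^sub>m m m \<longleftrightarrow> B = 0\<^sub>m m d"
proof
  assume 0: "B * mat_adjoint B = 0\<^sub>m m m"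
  have "row B i = 0\<^sub>v d" if i: "i < m" for i
  proof -
    have "row B i \<bullet>c row B i = (B * mat_adjoint B) $$ (i, i)"
      using B i by (auto simp: scalar_prod_def intro!: sum.cong)
    then have "row B i \<bullet>c row B i = 0" using 0 i by simp
    then show ?thesis
      using conjugate_square_eq_0_vec[of "row B i" d] row_carrier_vec[OF i B] by blast
  qed
  then show "B = 0\<^sub>m m d" using B by (intro eq_rowI) auto
qed (use B in \<open>auto intro!: eq_matI simp: scalar_prod_def\<close>)

lemma mat_vec_mult_unit:
  fixes A :: "'a::comm_semiring_1 mat"
  assumes "A \<in> carrier_mat m d" and "j < d"
  shows "A *\<^sub>v unit_vec d j = col A j"
  using assms by (intro eq_vecI) auto

lemma eq_mat_on_vecI:
  fixes A :: "'a::comm_semiring_1 mat"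
  assumes A: "A \<in> carrier_mat m d" and B: "B \<in> carrier_mat m d"
    and eq: "\<And>x. x \<in> carrier_vec d \<Longrightarrow> A *\<^sub>v x = B *\<^sub>v x"
  shows "A = B"
proof (rule mat_col_eqI)
  fix j assume "j < dim_col B"
  then show "col A j = col B j"
    using eq[of "unit_vec d j"] A B mat_vec_mult_unit[OF A] mat_vec_mult_unit[OF B] by simp
qed (use A B in auto)

section \<open>Scalars with square roots and orthonormal bases\<close>

text \<open>
  What the reals and the complex numbers have in common beyond the operations of
  \<^class>\<open>real_or_complex\<close>: nonnegative scalars are squared norms, so that vectors can be normalized,
  and the real part is compatible with translation by real scalars. In the second axiom the
  real scalar \<open>r\<close> is embedded by the class operation of scaling, as \<open>r *\<^sub>R 1\<close>.
\<close>

class hermitian_scalar_field = real_or_complex +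
  assumes conjugate_sqrt_exists: "0 \<le> x \<Longrightarrow> \<exists>s. s * conjugate s = x"
    and real_part_scaleR_one_add: "real_part (r *\<^sub>R 1 + x) = r + real_part x"

lemma real_part_of_real_add:
  "real_part (of_real r + x :: 'a::hermitian_scalar_field) = r + real_part x"
  unfolding of_real_def by (rule real_part_scaleR_one_add)

instance real :: hermitian_scalar_field
proof
  fix x r :: real
  show "0 \<le> x \<Longrightarrow> \<exists>s. s * conjugate s = x"
    by (rule exI[of _ "sqrt x"]) simp
  show "real_part (r *\<^sub>R 1 + x) = r + real_part x"
    by (simp add: real_part_real_def)
qed

instance complex :: hermitian_scalar_field
proof
  fix x :: complex and r :: real
  show "0 \<le> x \<Longrightarrow> \<exists>s. s * conjugate s = x"
    by (rule exI[of _ "of_real (sqrt (Re x))"]) (auto simp: less_eq_complex_def complex_eq_iff)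
  show "real_part (r *\<^sub>R 1 + x) = r + real_part x"
    by (simp add: real_part_complex_def)
qed

lemma normalizing_scalar_exists:
  fixes u :: "'a::hermitian_scalar_field vec"
  assumes "u \<bullet>c u \<noteq> 0"
  shows "\<exists>c. c * conjugate c * (u \<bullet>c u) = 1"
proof -
  obtain s where s: "s * conjugate s = u \<bullet>c u"
    using conjugate_sqrt_exists[OF conjugate_square_ge_0_vec[of u]] by blast
  then have s0: "s \<noteq> 0" using assms by auto
  then have "conjugate (inverse s) * conjugate s = 1"
    using conjugate_dist_mul[of "inverse s" s] by simp
  then have "inverse s * conjugate (inverse s) * (u \<bullet>c u) = 1"
    unfolding s[symmetric] using s0 by (simp add: mult_ac)
  then show ?thesis by blast
qed

text \<open>
  A maximal linearly independent subset of \<open>W\<close> is a basis of \<open>W\<close>; Gram-Schmidt turns it into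
  an orthogonal basis with the same number of elements, and each member is then rescaled to norm 1.
\<close>

lemma exists_onb_mat:
  fixes W :: "'a::hermitian_scalar_field vec set"
  assumes W: "VectorSpace.subspace class_ring W (module_vec TYPE('a) k)"
  shows "\<exists>L. is_onb_mat k (vectorspace.dim class_ring (module_vec TYPE('a) k \<lparr>carrier := W\<rparr>)) W L"
proof -
  interpret cof_vec_space k "TYPE('a)" .
  have sub: "submodule class_ring W V" using W by (simp add: subspace_def)
  then have WV: "W \<subseteq> carrier_vec k" by (simp add: submodule_def)
  interpret W: vectorspace class_ring "vs W" using W by (rule subspace_is_vs)
  define P where "P = (\<lambda>S. S \<subseteq> W \<and> lin_indpt S)"
  have bound: "finite A \<and> card A \<le> k" if "P A" for A
    using li_le_dim[of A] that WV dim_is_n by (auto simp: P_def)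
  have "P {}" by (simp add: P_def lin_dep_def)
  then obtain S where fin: "finite S" and max: "maximal S P"
    using maximal_exists[of P k, OF bound] by blast
  then have SW: "S \<subseteq> W" and li: "lin_indpt S" by (auto simp: maximal_def P_def)
  have "w \<in> span S" if w: "w \<in> W" for w
  proof (rule ccontr)
    assume notin: "w \<notin> span S"
    then have "w \<notin> S" using in_own_span[of S] SW WV by auto
    then have "lin_indpt (S \<union> {w})"
      using lin_dep_iff_in_span[of S w] SW WV w li notin by auto
    then have "S \<union> {w} = S" using max w SW unfolding maximal_def P_def by blast
    with \<open>w \<notin> S\<close> show False by auto
  qed
  then have span: "span S = W"
    using span_is_subset[OF SW sub] by auto
  have "W.basis S"
    using span li span_li_not_depend[OF SW sub] SW by (simp add: W.basis_def)
  then have dim: "W.dim = card S" using W.dim_basis[OF fin] by simp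
  obtain ws where ws: "set ws = S" "distinct ws" using finite_distinct_list[OF fin] by blast
  define us where "us = gram_schmidt k ws"
  have gs: "span (set us) = W" "corthogonal us" "set us \<subseteq> carrier_vec k" "length us = W.dim"
    using gram_schmidt_result[of ws us] ws li SW WV span dim us_def distinct_card[of ws] by auto
  have "\<forall>u\<in>set us. \<exists>c. c * conjugate c * (u \<bullet>c u) = 1"
    using corthogonalD[OF gs(2)] by (auto simp: in_set_conv_nth intro!: normalizing_scalar_exists)
  then obtain c where c: "\<And>u. u \<in> set us \<Longrightarrow> c u * conjugate (c u) * (u \<bullet>c u) = 1" by metis
  define vs where "vs = map (\<lambda>u. c u \<cdot>\<^sub>v u) us"
  define L where "L = mat_of_cols k vs"
  have vsV: "set vs \<subseteq> carrier_vec k" using gs(3) by (auto simp: vs_def)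
  have cols: "cols L = vs" unfolding L_def using vsV by simp
  have usW: "set us \<subseteq> W" using in_own_span[of "set us"] gs by auto
  have "set vs \<subseteq> W"
    using usW sub by (auto simp: vs_def submodule_def module_vec_simps class_ring_simps)
  then have "span (set vs) \<subseteq> W" using span_is_subset[OF _ sub] by blast
  moreover have "W \<subseteq> span (set vs)"
  proof -
    have own: "set vs \<subseteq> span (set vs)" using in_own_span[of "set vs"] vsV by simp
    have span_smult: "a \<cdot>\<^sub>v v \<in> span (set vs)" if "v \<in> span (set vs)" for a v
      using span_is_submodule[of "set vs"] vsV that
      by (auto simp: submodule_def module_vec_simps class_ring_simps)
    have "u \<in> span (set vs)" if u: "u \<in> set us" for u
    proof -
      have "c u \<cdot>\<^sub>v u \<in> set vs" using u by (simp add: vs_def)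
      then have "c u \<cdot>\<^sub>v u \<in> span (set vs)" by (rule subsetD[OF own])
      then have "inverse (c u) \<cdot>\<^sub>v (c u \<cdot>\<^sub>v u) \<in> span (set vs)" by (rule span_smult)
      moreover have "c u \<noteq> 0" using c[OF u] by auto
      ultimately show ?thesis by (simp add: smult_smult_assoc)
    qed
    then have "set us \<subseteq> span (set vs)" by (rule subsetI)
    then show ?thesis
      unfolding gs(1)[symmetric] by (rule span_is_subset[OF _ span_is_submodule]) (use vsV in simp)
  qed
  ultimately have "span (set (cols L)) = W" unfolding cols by (rule subset_antisym)
  moreover have "L \<in> carrier_mat k W.dim"
    using mat_of_cols_carrier(1)[of k vs] gs(4) by (simp add: L_def vs_def)
  moreover have "col L i \<bullet>c col L j = (if i = j then 1 else 0)" if i: "i < W.dim" and j: "j < W.dim" for i j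
  proof -
    have uc: "us ! i \<in> carrier_vec k" "us ! j \<in> carrier_vec k" using gs(3,4) i j by auto
    have "col L i \<bullet>c col L j = (c (us ! i) \<cdot>\<^sub>v us ! i) \<bullet>c (c (us ! j) \<cdot>\<^sub>v us ! j)"
      using i j gs(4) uc by (simp add: L_def vs_def)
    also have "\<dots> = c (us ! i) * conjugate (c (us ! j)) * (us ! i \<bullet>c us ! j)"
      using uc by (simp add: conjugate_smult_vec mult_ac)
    also have "\<dots> = (if i = j then 1 else 0)"
      using c[of "us ! i"] corthogonalD[OF gs(2), of i j] i j gs(4) by auto
    finally show ?thesis .
  qed
  ultimately show ?thesis unfolding is_onb_mat_def by blast
qed

section \<open>Orthogonal complements and projections\<close>

lemma is_onb_mat_onb_mat: "is_onb_mat k m W L \<Longrightarrow> is_onb_mat k m W (onb_mat k m W)"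
  unfolding onb_mat_def by (rule someI[of "is_onb_mat k m W"])

lemma is_onb_matD:
  fixes W :: "'a::conjugatable_field vec set"
  assumes "is_onb_mat k m W L"
  shows "L \<in> carrier_mat k m" "mat_adjoint L * L = 1\<^sub>m m" "W = (\<lambda>y. L *\<^sub>v y) ` carrier_vec m"
proof -
  have L: "L \<in> carrier_mat k m"
    and orth: "\<forall>i<m. \<forall>j<m. col L i \<bullet>c col L j = (if i = j then 1 else 0)"
    and span: "LinearCombinations.module.span class_ring (module_vec TYPE('a) k) (set (cols L)) = W"
    using assms unfolding is_onb_mat_def by blast+
  show "L \<in> carrier_mat k m" by (fact L)
  show "mat_adjoint L * L = 1\<^sub>m m"
  proof (rule eq_matI)
    fix i j assume ij: "i < dim_row (1\<^sub>m m :: 'a mat)" "j < dim_col (1\<^sub>m m :: 'a mat)"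
    have "(mat_adjoint L * L) $$ (i, j) = col L j \<bullet>c col L i"
      using L ij by (auto simp: scalar_prod_def mult.commute intro!: sum.cong)
    then show "(mat_adjoint L * L) $$ (i, j) = 1\<^sub>m m $$ (i, j)"
      using orth ij by simp
  qed (use L in auto)
  interpret vec_space "TYPE('a)" k .
  have "W = {y \<in> carrier_vec (dim_row L). \<exists>x\<in>carrier_vec (dim_col L). L *\<^sub>v x = y}"
    using col_space_eq[OF L] unfolding col_space_def span .
  then show "W = (\<lambda>y. L *\<^sub>v y) ` carrier_vec m" using L by force
qed

text \<open>
  The pairing of \<open>x\<close> with \<open>L y\<close> is that of \<open>L\<^sup>* x\<close> with \<open>y\<close>. If it vanishes for all \<open>y\<close>, the choice
  \<open>y = L\<^sup>* x\<close> shows \<open>L\<^sup>* x = 0\<close>, because the form is definite.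
\<close>

lemma orth_compl_range:
  fixes L :: "'a::conjugatable_ordered_field mat"
  assumes L: "L \<in> carrier_mat k m" and W: "W = (\<lambda>y. L *\<^sub>v y) ` carrier_vec m"
  shows "orth_compl k W = {x \<in> carrier_vec k. mat_adjoint L *\<^sub>v x = 0\<^sub>v m}"
proof -
  have "(\<forall>w\<in>W. x \<bullet>c w = 0) \<longleftrightarrow> mat_adjoint L *\<^sub>v x = 0\<^sub>v m" if x: "x \<in> carrier_vec k" for x
  proof
    let ?z = "mat_adjoint L *\<^sub>v x"
    have z: "?z \<in> carrier_vec m" using mat_adjoint_carrier[OF L] x by simp
    assume "\<forall>w\<in>W. x \<bullet>c w = 0"
    then have "x \<bullet>c (L *\<^sub>v ?z) = 0" using z W by blast
    then have "?z \<bullet>c ?z = 0" using cscalar_prod_mult_mat_vec[OF L x z] by simp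
    then show "?z = 0\<^sub>v m" using conjugate_square_eq_0_vec[OF z] by blast
  next
    assume "mat_adjoint L *\<^sub>v x = 0\<^sub>v m"
    then show "\<forall>w\<in>W. x \<bullet>c w = 0" using cscalar_prod_mult_mat_vec[OF L x] W by auto
  qed
  then show ?thesis by (auto simp: orth_compl_def)
qed

lemma orth_compl_subspace:
  fixes W :: "'a::conjugatable_field vec set"
  assumes "W \<subseteq> carrier_vec k"
  shows "VectorSpace.subspace class_ring (orth_compl k W) (module_vec TYPE('a) k)"
proof -
  interpret vec_space "TYPE('a)" k .
  have "submodule class_ring (orth_compl k W) V"
    using assms vec_module[of k]
    by (auto simp: submodule_def orth_compl_def module_vec_simps class_ring_simps
        add_scalar_prod_distrib[of _ k] subset_iff)
  then show ?thesis by (simp add: VectorSpace.subspace_def vec_vs)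
qed

lemma mult_adjoint_mult_vec:
  fixes L :: "'a::conjugatable_field mat"
  assumes L: "L \<in> carrier_mat k m" and LL: "mat_adjoint L * L = 1\<^sub>m m" and y: "y \<in> carrier_vec m"
  shows "mat_adjoint L *\<^sub>v (L *\<^sub>v y) = y"
  using assoc_mult_mat_vec[OF mat_adjoint_carrier[OF L] L y] LL y by simp

text \<open>
  The matrix \<open>L * mat_adjoint L\<close> maps into the range of \<open>L\<close>, and its residuals are annihilated
  by \<open>mat_adjoint L\<close>, that is, orthogonal to \<open>W\<close>. For uniqueness, write the image of \<open>x\<close> under
  a competitor as \<open>L *\<^sub>v y\<close>: applying \<open>mat_adjoint L\<close> to the residual forces
  \<open>y = mat_adjoint L *\<^sub>v x\<close>.
\<close>

lemma orth_proj_eq: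
  fixes W :: "'a::conjugatable_ordered_field vec set"
  assumes "is_onb_mat k m W L"
  shows "orth_proj k W = L * mat_adjoint L"
proof -
  note L = is_onb_matD(1)[OF assms] and LL = is_onb_matD(2)[OF assms] and W = is_onb_matD(3)[OF assms]
  note L' = mat_adjoint_carrier[OF L]
  note oc = orth_compl_range[OF L W]
  have LLx: "(L * mat_adjoint L) *\<^sub>v x = L *\<^sub>v (mat_adjoint L *\<^sub>v x)" if "x \<in> carrier_vec k" for x
    using assoc_mult_mat_vec[OF L L' that] .
  have L'x: "mat_adjoint L *\<^sub>v x \<in> carrier_vec m" if "x \<in> carrier_vec k" for x
    using L' that by simp
  have residual: "mat_adjoint L *\<^sub>v (x - L *\<^sub>v y) = mat_adjoint L *\<^sub>v x - y"
    if "x \<in> carrier_vec k" "y \<in> carrier_vec m" for x y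
    using mult_minus_distrib_mat_vec[OF L' that(1), of "L *\<^sub>v y"] L that
      mult_adjoint_mult_vec[OF L LL that(2)] by simp
  show ?thesis
    unfolding orth_proj_def
  proof (rule the_equality)
    have "(L * mat_adjoint L) *\<^sub>v x \<in> W \<and> x - (L * mat_adjoint L) *\<^sub>v x \<in> orth_compl k W"
      if x: "x \<in> carrier_vec k" for x
    proof
      show "(L * mat_adjoint L) *\<^sub>v x \<in> W"
        unfolding LLx[OF x] by (subst W) (rule imageI[OF L'x[OF x]])
      have "mat_adjoint L *\<^sub>v (x - L *\<^sub>v (mat_adjoint L *\<^sub>v x)) = 0\<^sub>v m"
        using residual[OF x L'x[OF x]] L'x[OF x] by simp
      moreover have "x - L *\<^sub>v (mat_adjoint L *\<^sub>v x) \<in> carrier_vec k"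
        using x L'x[OF x] L by simp
      ultimately show "x - (L * mat_adjoint L) *\<^sub>v x \<in> orth_compl k W"
        unfolding oc LLx[OF x] by simp
    qed
    then show "L * mat_adjoint L \<in> carrier_mat k k \<and>
      (\<forall>x\<in>carrier_vec k. (L * mat_adjoint L) *\<^sub>v x \<in> W \<and> x - (L * mat_adjoint L) *\<^sub>v x \<in> orth_compl k W)"
      using mult_carrier_mat[OF L L'] by blast
  next
    fix P assume P: "P \<in> carrier_mat k k \<and>
      (\<forall>x\<in>carrier_vec k. P *\<^sub>v x \<in> W \<and> x - P *\<^sub>v x \<in> orth_compl k W)"
    show "P = L * mat_adjoint L"
    proof (rule eq_mat_on_vecI[of _ k k])
      fix x :: "'a vec" assume x: "x \<in> carrier_vec k"
      then have Px: "P *\<^sub>v x \<in> W" "x - P *\<^sub>v x \<in> orth_compl k W" using P by blast+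
      then obtain y where y: "y \<in> carrier_vec m" "P *\<^sub>v x = L *\<^sub>v y" using W by blast
      have "mat_adjoint L *\<^sub>v (x - P *\<^sub>v x) = 0\<^sub>v m" using Px(2) unfolding oc by simp
      then have "mat_adjoint L *\<^sub>v x - y = 0\<^sub>v m" unfolding y(2) residual[OF x y(1)] .
      then have "mat_adjoint L *\<^sub>v x = y"
        using y(1) L'x[OF x] L by (auto simp: vec_eq_iff)
      then show "P *\<^sub>v x = (L * mat_adjoint L) *\<^sub>v x" using LLx[OF x] y by simp
    qed (use P L L' in auto)
  qed
qed

text \<open>
  The conditions say that \<open>L\<close> and \<open>M\<close> placed side by side form a unitary matrix. All later arguments
  about a subspace and its orthogonal complement use only these matrix identities.
\<close>

definition complementary_onbs :: "nat \<Rightarrow> nat \<Rightarrow> nat \<Rightarrow> 'a::conjugatable_field mat \<Rightarrow> 'a mat \<Rightarrow> bool" where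
  "complementary_onbs k m d L M \<longleftrightarrow> L \<in> carrier_mat k m \<and> M \<in> carrier_mat k d \<and>
     mat_adjoint L * L = 1\<^sub>m m \<and> mat_adjoint M * M = 1\<^sub>m d \<and>
     L * mat_adjoint L + M * mat_adjoint M = 1\<^sub>m k"

lemma complementary_onbs_sym:
  assumes "complementary_onbs k m d L M"
  shows "complementary_onbs k d m M L"
proof -
  have "L * mat_adjoint L \<in> carrier_mat k k" "M * mat_adjoint M \<in> carrier_mat k k"
    using assms by (auto simp: complementary_onbs_def)
  then have "M * mat_adjoint M + L * mat_adjoint L = L * mat_adjoint L + M * mat_adjoint M"
    by (intro comm_add_mat)
  then show ?thesis using assms by (simp add: complementary_onbs_def)
qed

lemma complementary_onbs_proj:
  fixes L :: "'a::conjugatable_field mat"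
  assumes "complementary_onbs k m d L M"
  shows "M * mat_adjoint M = 1\<^sub>m k - L * mat_adjoint L"
proof -
  have "Q = (P + Q) - P" if "P \<in> carrier_mat k k" "Q \<in> carrier_mat k k" for P Q :: "'a mat"
    using that by (intro eq_matI) auto
  moreover have "L * mat_adjoint L \<in> carrier_mat k k" "M * mat_adjoint M \<in> carrier_mat k k"
    using assms by (auto simp: complementary_onbs_def)
  ultimately have "M * mat_adjoint M = (L * mat_adjoint L + M * mat_adjoint M) - L * mat_adjoint L"
    by blast
  then show ?thesis using assms by (simp add: complementary_onbs_def)
qed

text \<open>
  The residual \<open>x - L (L\<^sup>* x)\<close> lies in the orthogonal complement, so it equals \<open>M z\<close> for some \<open>z\<close>.
  Since \<open>M\<^sup>* L = 0\<close>, applying \<open>M\<^sup>*\<close> gives \<open>z = M\<^sup>* x\<close>, which is the completeness relation at \<open>x\<close>.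
\<close>

lemma complementary_onbsI:
  fixes W :: "'a::conjugatable_ordered_field vec set"
  assumes LW: "is_onb_mat k m W L" and MW: "is_onb_mat k d (orth_compl k W) M"
  shows "complementary_onbs k m d L M"
proof -
  note L = is_onb_matD(1)[OF LW] and LL = is_onb_matD(2)[OF LW] and W = is_onb_matD(3)[OF LW]
  note M = is_onb_matD(1)[OF MW] and MM = is_onb_matD(2)[OF MW] and W' = is_onb_matD(3)[OF MW]
  note L' = mat_adjoint_carrier[OF L] and M' = mat_adjoint_carrier[OF M]
  note oc = orth_compl_range[OF L W]
  have "mat_adjoint L * M = 0\<^sub>m m d"
  proof (rule eq_mat_on_vecI[of _ m d])
    fix y :: "'a vec" assume y: "y \<in> carrier_vec d"
    then have "mat_adjoint L *\<^sub>v (M *\<^sub>v y) = 0\<^sub>v m" using W' oc by blast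
    then show "mat_adjoint L * M *\<^sub>v y = 0\<^sub>m m d *\<^sub>v y"
      using y assoc_mult_mat_vec[OF L' M y] by auto
  qed (use L' M in auto)
  then have "mat_adjoint (mat_adjoint L * M) = 0\<^sub>m d m" by (intro eq_matI) auto
  then have MsL: "mat_adjoint M * L = 0\<^sub>m d m" using mat_adjoint_mult[OF L' M] by simp
  have "L * mat_adjoint L + M * mat_adjoint M = 1\<^sub>m k"
  proof (rule eq_mat_on_vecI[of _ k k])
    fix x :: "'a vec" assume x: "x \<in> carrier_vec k"
    let ?y = "mat_adjoint L *\<^sub>v x"
    have y: "?y \<in> carrier_vec m" using L' x by simp
    have Ly: "L *\<^sub>v ?y \<in> carrier_vec k" using L y by simp
    have "mat_adjoint L *\<^sub>v (x - L *\<^sub>v ?y) = ?y - ?y"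
      using mult_minus_distrib_mat_vec[OF L' x Ly] mult_adjoint_mult_vec[OF L LL y] by simp
    then have "x - L *\<^sub>v ?y \<in> orth_compl k W" using x Ly y by (simp add: oc)
    then obtain z where z: "z \<in> carrier_vec d" "x - L *\<^sub>v ?y = M *\<^sub>v z" using W' by blast
    have "z = mat_adjoint M *\<^sub>v (x - L *\<^sub>v ?y)" using mult_adjoint_mult_vec[OF M MM z(1)] z(2) by simp
    also have "\<dots> = mat_adjoint M *\<^sub>v x - (mat_adjoint M * L) *\<^sub>v ?y"
      using mult_minus_distrib_mat_vec[OF M' x Ly] assoc_mult_mat_vec[OF M' L y] by simp
    also have "\<dots> = mat_adjoint M *\<^sub>v x" using MsL M' x y by (auto intro!: eq_vecI)
    finally have "L *\<^sub>v ?y + M *\<^sub>v (mat_adjoint M *\<^sub>v x) = L *\<^sub>v ?y + (x - L *\<^sub>v ?y)" using z(2) by simp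
    also have "\<dots> = x" using x carrier_vecD[OF Ly] by (intro eq_vecI) (auto simp del: dim_mult_mat_vec index_mult_mat_vec)
    finally show "(L * mat_adjoint L + M * mat_adjoint M) *\<^sub>v x = 1\<^sub>m k *\<^sub>v x"
      using x L L' M M' by (simp add: add_mult_distrib_mat_vec[of _ k k])
  qed (use L L' M M' in auto)
  then show ?thesis using L LL M MM by (simp add: complementary_onbs_def)
qed

text \<open>
  Taking traces in \<open>L * mat_adjoint L + M * mat_adjoint M = 1\<close> gives the dimension formula, and so
  the complement of an \<open>m\<close>-dimensional subspace has dimension \<open>k - m\<close>.
\<close>

lemma complementary_onbs_dim:
  fixes L :: "'a::{conjugatable_field, ring_char_0} mat"
  assumes "complementary_onbs k m d L M"
  shows "m + d = k"
proof -
  have L: "L \<in> carrier_mat k m" and M: "M \<in> carrier_mat k d" using assms by (auto simp: complementary_onbs_def)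
  note L' = mat_adjoint_carrier[OF L] and M' = mat_adjoint_carrier[OF M]
  have "of_nat k = mat_trace (L * mat_adjoint L + M * mat_adjoint M)"
    using assms by (simp add: complementary_onbs_def mat_trace_one)
  also have "\<dots> = mat_trace (mat_adjoint L * L) + mat_trace (mat_adjoint M * M)"
    using mat_trace_add[of "L * mat_adjoint L" k "M * mat_adjoint M"]
      mat_trace_mult_comm[OF L L'] mat_trace_mult_comm[OF M M'] L L' M M' by simp
  also have "\<dots> = of_nat (m + d)"
    using assms by (simp add: complementary_onbs_def mat_trace_one)
  finally show ?thesis by (simp only: of_nat_eq_iff)
qed

lemma Gr_onb_mat:
  fixes W :: "'a::hermitian_scalar_field vec set"
  assumes "W \<in> Gr k m"
  shows "is_onb_mat k m W (onb_mat k m W)"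
    and "is_onb_mat k (k - m) (orth_compl k W) (onb_mat k (k - m) (orth_compl k W))"
proof -
  obtain L where "is_onb_mat k m W L"
    using exists_onb_mat[of W k] assms by (auto simp: Gr_def)
  then show 1: "is_onb_mat k m W (onb_mat k m W)" by (rule is_onb_mat_onb_mat)
  have "W \<subseteq> carrier_vec k" using is_onb_matD(1)[OF 1] by (subst is_onb_matD(3)[OF 1]) auto
  then obtain d M where M: "is_onb_mat k d (orth_compl k W) M"
    using exists_onb_mat[OF orth_compl_subspace] by blast
  have "m + d = k" using complementary_onbs_dim[OF complementary_onbsI[OF 1 M]] .
  then have d: "d = k - m" by simp
  show "is_onb_mat k (k - m) (orth_compl k W) (onb_mat k (k - m) (orth_compl k W))"
    unfolding d[symmetric] using M by (rule is_onb_mat_onb_mat)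
qed

section \<open>Cross-Gramians of complements\<close>

text \<open>
  Replace the projection onto the second subspace by the identity minus the projection onto its
  complement. The matrix \<open>mat_adjoint L * M'\<close> compares the first subspace with the
  complement of the second.
\<close>

lemma complementary_onbs_cross:
  fixes L :: "'a::conjugatable_field mat"
  assumes 1: "complementary_onbs k m d L M" and 2: "complementary_onbs k m' d' L' M'"
  shows "mat_adjoint L * L' * mat_adjoint L' * L
    = 1\<^sub>m m - (mat_adjoint L * M') * mat_adjoint (mat_adjoint L * M')"
proof -
  have L: "L \<in> carrier_mat k m" and L': "L' \<in> carrier_mat k m'" and M': "M' \<in> carrier_mat k d'"
    and LL: "mat_adjoint L * L = 1\<^sub>m m"
    using 1 2 by (auto simp: complementary_onbs_def)
  note aL = mat_adjoint_carrier[OF L] and aL' = mat_adjoint_carrier[OF L'] and aM' = mat_adjoint_carrier[OF M']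
  have P: "M' * mat_adjoint M' \<in> carrier_mat k k" using M' aM' by simp
  have "mat_adjoint L * L' * mat_adjoint L' * L = mat_adjoint L * (L' * mat_adjoint L') * L"
    using assoc_mult_mat[OF aL L' aL'] by simp
  also have "\<dots> = mat_adjoint L * (1\<^sub>m k - M' * mat_adjoint M') * L"
    using complementary_onbs_proj[OF complementary_onbs_sym[OF 2]] by simp
  also have "\<dots> = mat_adjoint L * L - mat_adjoint L * (M' * mat_adjoint M') * L"
    using mult_minus_distrib_mat[OF aL one_carrier_mat P] right_mult_one_mat[OF aL]
      minus_mult_distrib_mat[OF aL mult_carrier_mat[OF aL P] L] by simp
  also have "mat_adjoint L * (M' * mat_adjoint M') * L = (mat_adjoint L * M') * (mat_adjoint M' * L)"
    using assoc_mult_mat[OF aL M' aM'] assoc_mult_mat[OF mult_carrier_mat[OF aL M'] aM' L] by simp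
  also have "mat_adjoint M' * L = mat_adjoint (mat_adjoint L * M')"
    using mat_adjoint_mult[OF aL M'] by simp
  finally show ?thesis using LL by simp
qed

text \<open>
  The product vanishes exactly when \<open>W\<close> is orthogonal to the complement of \<open>W'\<close>, that is, when it is
  contained in the double complement \<open>W'\<close>.
\<close>

lemma adjoint_mult_eq_0_iff_subset:
  fixes W :: "'a::conjugatable_ordered_field vec set"
  assumes LW: "is_onb_mat k m W L" and LW': "is_onb_mat k m' W' L'"
    and MW': "is_onb_mat k d (orth_compl k W') M'"
  shows "mat_adjoint L * M' = 0\<^sub>m m d \<longleftrightarrow> W \<subseteq> W'"
proof -
  note L = is_onb_matD(1)[OF LW] and W = is_onb_matD(3)[OF LW]
  note L' = is_onb_matD(1)[OF LW'] and W' = is_onb_matD(3)[OF LW']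
  note M' = is_onb_matD(1)[OF MW']
  note aL = mat_adjoint_carrier[OF L] and aL' = mat_adjoint_carrier[OF L'] and aM' = mat_adjoint_carrier[OF M']
  note c = complementary_onbsI[OF LW' MW']
  have split: "L' *\<^sub>v (mat_adjoint L' *\<^sub>v x) + M' *\<^sub>v (mat_adjoint M' *\<^sub>v x) = x"
    if x: "x \<in> carrier_vec k" for x
  proof -
    have "(L' * mat_adjoint L' + M' * mat_adjoint M') *\<^sub>v x = x"
      using c x by (simp add: complementary_onbs_def)
    then show ?thesis
      using x L' aL' M' aM' by (simp add: add_mult_distrib_mat_vec[of _ k k])
  qed
  have M'L: "mat_adjoint M' * L = mat_adjoint (mat_adjoint L * M')"
    using mat_adjoint_mult[OF aL M'] by simp
  show ?thesis
  proof
    assume "mat_adjoint L * M' = 0\<^sub>m m d"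
    then have 0: "mat_adjoint M' * L = 0\<^sub>m d m" unfolding M'L by (intro eq_matI) auto
    show "W \<subseteq> W'"
    proof
      fix w assume "w \<in> W"
      then obtain y where y: "y \<in> carrier_vec m" "w = L *\<^sub>v y" using W by blast
      have w: "w \<in> carrier_vec k" using L y by simp
      have "mat_adjoint M' *\<^sub>v w = 0\<^sub>v d"
        using assoc_mult_mat_vec[OF aM' L y(1), symmetric] y unfolding 0 by (auto intro!: eq_vecI)
      moreover have "M' *\<^sub>v 0\<^sub>v d = 0\<^sub>v k" using M' by (intro eq_vecI) auto
      moreover have y': "mat_adjoint L' *\<^sub>v w \<in> carrier_vec m'" using aL' w by simp
      ultimately have "L' *\<^sub>v (mat_adjoint L' *\<^sub>v w) = w"
        using split[OF w] L' by (metis mult_mat_vec_carrier right_zero_vec)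
      then show "w \<in> W'" using imageI[OF y', of "\<lambda>y. L' *\<^sub>v y"] W' by simp
    qed
  next
    assume sub: "W \<subseteq> W'"
    show "mat_adjoint L * M' = 0\<^sub>m m d"
    proof (rule eq_mat_on_vecI[of _ m d])
      fix z :: "'a vec" assume z: "z \<in> carrier_vec d"
      then have "M' *\<^sub>v z \<in> orth_compl k W'" using is_onb_matD(3)[OF MW'] by blast
      then have "M' *\<^sub>v z \<in> orth_compl k W" using sub by (auto simp: orth_compl_def)
      then have "mat_adjoint L *\<^sub>v (M' *\<^sub>v z) = 0\<^sub>v m" using orth_compl_range[OF L W] by blast
      then show "mat_adjoint L * M' *\<^sub>v z = 0\<^sub>m m d *\<^sub>v z"
        using z assoc_mult_mat_vec[OF aL M' z] by auto
    qed (use aL M' in auto)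
  qed
qed

text \<open>
  The key relation: one matrix \<open>B\<close> controls both cross-Gramians, once through \<open>B * mat_adjoint B\<close> and
  once through \<open>mat_adjoint B * B\<close>. The two subspaces trade places on the side of the complements;
  this is harmless because all the notions below quantify over ordered pairs of distinct indices.
\<close>

lemma cross_gram_complement:
  fixes W W' :: "'a::hermitian_scalar_field vec set"
  assumes W: "W \<in> Gr k m" and W': "W' \<in> Gr k m"
  obtains B where "B \<in> carrier_mat m (k - m)"
    and "cross_gram k m W W' = 1\<^sub>m m - B * mat_adjoint B"
    and "cross_gram k (k - m) (orth_compl k W') (orth_compl k W) = 1\<^sub>m (k - m) - mat_adjoint B * B"
    and "B = 0\<^sub>m m (k - m) \<longleftrightarrow> W \<subseteq> W'"
proof -
  define L L' M M' where defs: "L = onb_mat k m W" "L' = onb_mat k m W'"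
    "M = onb_mat k (k - m) (orth_compl k W)" "M' = onb_mat k (k - m) (orth_compl k W')"
  note onb = Gr_onb_mat[OF W, folded defs] and onb' = Gr_onb_mat[OF W', folded defs]
  note c = complementary_onbsI[OF onb] and c' = complementary_onbsI[OF onb']
  note aL = mat_adjoint_carrier[OF is_onb_matD(1)[OF onb(1)]] and M' = is_onb_matD(1)[OF onb'(2)]
  have adj: "mat_adjoint M' * L = mat_adjoint (mat_adjoint L * M')"
    using mat_adjoint_mult[OF aL M'] by simp
  show ?thesis
  proof
    show "mat_adjoint L * M' \<in> carrier_mat m (k - m)" using aL M' by simp
    show "cross_gram k m W W' = 1\<^sub>m m - (mat_adjoint L * M') * mat_adjoint (mat_adjoint L * M')"
      using complementary_onbs_cross[OF c c'] by (simp only: cross_gram_def Let_def defs)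
    show "cross_gram k (k - m) (orth_compl k W') (orth_compl k W)
        = 1\<^sub>m (k - m) - mat_adjoint (mat_adjoint L * M') * (mat_adjoint L * M')"
      using complementary_onbs_cross[OF complementary_onbs_sym[OF c'] complementary_onbs_sym[OF c]]
      unfolding adj mat_adjoint_adjoint by (simp only: cross_gram_def Let_def defs)
    show "mat_adjoint L * M' = 0\<^sub>m m (k - m) \<longleftrightarrow> W \<subseteq> W'"
      by (rule adjoint_mult_eq_0_iff_subset[OF onb(1) onb'])
  qed
qed

lemma mat_trace_cross_gram_complement:
  fixes W W' :: "'a::hermitian_scalar_field vec set"
  assumes "W \<in> Gr k m" "W' \<in> Gr k m"
  shows "mat_trace (cross_gram k (k - m) (orth_compl k W') (orth_compl k W)) + of_nat m
    = mat_trace (cross_gram k m W W') + of_nat (k - m)"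
proof -
  obtain B where B: "B \<in> carrier_mat m (k - m)"
    and 1: "cross_gram k m W W' = 1\<^sub>m m - B * mat_adjoint B"
    and 2: "cross_gram k (k - m) (orth_compl k W') (orth_compl k W) = 1\<^sub>m (k - m) - mat_adjoint B * B"
    using cross_gram_complement[OF assms] by metis
  note B' = mat_adjoint_carrier[OF B]
  show ?thesis
    unfolding 1 2
    using mat_trace_mult_comm[OF B B'] mat_trace_minus[OF one_carrier_mat mult_carrier_mat[OF B B']]
      mat_trace_minus[OF one_carrier_mat mult_carrier_mat[OF B' B]]
    by (simp add: mat_trace_one)
qed

lemma proots_cross_gram_complement:
  fixes W W' :: "'a::hermitian_scalar_field vec set"
  assumes "W \<in> Gr k m" "W' \<in> Gr k m"
  shows "proots (char_poly (cross_gram k (k - m) (orth_compl k W') (orth_compl k W))) + replicate_mset m 1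
    = proots (char_poly (cross_gram k m W W')) + replicate_mset (k - m) 1"
proof -
  obtain B where B: "B \<in> carrier_mat m (k - m)"
    and 1: "cross_gram k m W W' = 1\<^sub>m m - B * mat_adjoint B"
    and 2: "cross_gram k (k - m) (orth_compl k W') (orth_compl k W) = 1\<^sub>m (k - m) - mat_adjoint B * B"
    using cross_gram_complement[OF assms] by metis
  note B' = mat_adjoint_carrier[OF B]
  have nz: "char_poly A \<noteq> 0" if "A \<in> carrier_mat p p" for A :: "'a mat" and p
    using degree_monic_char_poly[OF that] by auto
  have "char_poly (cross_gram k m W W') \<noteq> 0"
    unfolding 1 using B B' by (intro nz[of _ m] minus_carrier_mat) auto
  moreover have "char_poly (cross_gram k (k - m) (orth_compl k W') (orth_compl k W)) \<noteq> 0"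
    unfolding 2 using B B' by (intro nz[of _ "k - m"] minus_carrier_mat) auto
  moreover have "proots ([:- 1, 1:] ^ p :: 'a poly) = replicate_mset p 1" for p
    by (simp add: proots_power)
  ultimately show ?thesis
    using arg_cong[OF char_poly_one_minus_mult_comm[OF B B', folded 1 2], of proots]
    by (simp add: proots_mult add.commute)
qed

text \<open>
  Evaluating \<open>B * mat_adjoint B * B\<close> in two ways gives \<open>a \<cdot>\<^sub>m B = b \<cdot>\<^sub>m B\<close>. If \<open>B\<close> is nonzero, then
  \<open>a = b\<close>, and comparing the traces of the two products gives \<open>a * m = a * d\<close> with \<open>a\<close> nonzero.
\<close>

lemma scalar_grams_imp_zero_or_square:
  fixes B :: "'a::{conjugatable_ordered_field, ring_char_0} mat"
  assumes B: "B \<in> carrier_mat m d"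
    and a: "B * mat_adjoint B = a \<cdot>\<^sub>m 1\<^sub>m m" and b: "mat_adjoint B * B = b \<cdot>\<^sub>m 1\<^sub>m d"
  shows "B = 0\<^sub>m m d \<or> m = d"
proof (cases "a = b")
  case True
  note B' = mat_adjoint_carrier[OF B]
  have "a * of_nat m = b * of_nat d"
    using mat_trace_mult_comm[OF B B'] mat_trace_smult[OF one_carrier_mat, of a m]
      mat_trace_smult[OF one_carrier_mat, of b d] unfolding a b
    by (simp add: mat_trace_one)
  then have "a = 0 \<or> m = d" using True by (simp add: of_nat_eq_iff)
  moreover have "B = 0\<^sub>m m d" if "a = 0"
  proof -
    have "B * mat_adjoint B = 0\<^sub>m m m" unfolding a that by (intro eq_matI) auto
    then show ?thesis using mult_adjoint_eq_0_iff[OF B] by blast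
  qed
  ultimately show ?thesis by blast
next
  case False
  note B' = mat_adjoint_carrier[OF B]
  have "a \<cdot>\<^sub>m B = (B * mat_adjoint B) * B"
    unfolding a using B by (simp add: mult_smult_assoc_mat[of _ m m])
  also have "\<dots> = B * (mat_adjoint B * B)" using B B' by (simp add: assoc_mult_mat[of _ m d])
  also have "\<dots> = b \<cdot>\<^sub>m B"
    unfolding b using mult_smult_distrib[OF B one_carrier_mat, of b] right_mult_one_mat[OF B] by simp
  finally have eq: "a \<cdot>\<^sub>m B = b \<cdot>\<^sub>m B" .
  have "B $$ (i, j) = 0" if "i < m" "j < d" for i j
    using arg_cong[OF eq, of "\<lambda>A. A $$ (i, j)"] B that False by simp
  then show ?thesis using B by (auto intro!: eq_matI)
qed

text \<open>
  For nonzero \<open>a\<close> the adjoint of \<open>B\<close> is a multiple of the inverse of \<open>B\<close>, so it commutes with \<open>B\<close>;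
  for \<open>a = 0\<close> the matrix \<open>B\<close> itself is zero.
\<close>

lemma square_scalar_gram_commute:
  fixes B :: "'a::conjugatable_ordered_field mat"
  assumes B: "B \<in> carrier_mat m m" and a: "B * mat_adjoint B = a \<cdot>\<^sub>m 1\<^sub>m m"
  shows "mat_adjoint B * B = a \<cdot>\<^sub>m 1\<^sub>m m"
proof (cases "a = 0")
  case True
  then have "B * mat_adjoint B = 0\<^sub>m m m" using a by (auto intro!: eq_matI)
  then have "B = 0\<^sub>m m m" using mult_adjoint_eq_0_iff[OF B] by blast
  then show ?thesis using True by (auto intro!: eq_matI simp: scalar_prod_def)
next
  case False
  note B' = mat_adjoint_carrier[OF B]
  have "B * (inverse a \<cdot>\<^sub>m mat_adjoint B) = inverse a \<cdot>\<^sub>m (a \<cdot>\<^sub>m 1\<^sub>m m)"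
    using mult_smult_distrib[OF B B'] a by simp
  also have "\<dots> = 1\<^sub>m m" using False by (auto intro!: eq_matI)
  finally have "(inverse a \<cdot>\<^sub>m mat_adjoint B) * B = 1\<^sub>m m"
    using mat_mult_left_right_inverse[OF B smult_carrier_mat[OF B']] by blast
  then have "inverse a \<cdot>\<^sub>m (mat_adjoint B * B) = 1\<^sub>m m"
    using mult_smult_assoc_mat[OF B' B] by simp
  then have "a \<cdot>\<^sub>m (inverse a \<cdot>\<^sub>m (mat_adjoint B * B)) = a \<cdot>\<^sub>m 1\<^sub>m m" by simp
  moreover have "a \<cdot>\<^sub>m (inverse a \<cdot>\<^sub>m (mat_adjoint B * B)) = mat_adjoint B * B"
    using B B' False by (intro eq_matI) auto
  ultimately show ?thesis by simp
qed

section \<open>Equichordal, strongly simplicial and equiisoclinic collections\<close>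

text \<open>
  Passing to complements changes traces and eigenvalue multisets only by fixed summands (and swaps the
  two indices), which preserves constancy off the diagonal. Cancellation takes the place of subtraction
  so that numbers and multisets are covered at once.
\<close>

lemma offdiagonal_constant_iff:
  fixes f g :: "'i \<Rightarrow> 'i \<Rightarrow> 'b::cancel_ab_semigroup_add"
  assumes fg: "\<And>i j. i \<in> I \<Longrightarrow> j \<in> I \<Longrightarrow> g j i + u = f i j + v"
  shows "(\<exists>c. \<forall>i\<in>I. \<forall>j\<in>I. i \<noteq> j \<longrightarrow> f i j = c) \<longleftrightarrow> (\<exists>c. \<forall>i\<in>I. \<forall>j\<in>I. i \<noteq> j \<longrightarrow> g i j = c)"
proof -
  have const: "\<exists>c. \<forall>i\<in>I. \<forall>j\<in>I. i \<noteq> j \<longrightarrow> g i j = c"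
    if fg: "\<And>i j. i \<in> I \<Longrightarrow> j \<in> I \<Longrightarrow> g j i + u = f i j + v"
      and c: "\<forall>i\<in>I. \<forall>j\<in>I. i \<noteq> j \<longrightarrow> f i j = c" for f g :: "'i \<Rightarrow> 'i \<Rightarrow> 'b" and u v c
  proof (cases "\<exists>i\<in>I. \<exists>j\<in>I. i \<noteq> j")
    case True
    then obtain p q where pq: "p \<in> I" "q \<in> I" "p \<noteq> q" by blast
    show ?thesis
    proof (intro exI ballI impI)
      fix i j assume ij: "i \<in> I" "j \<in> I" "i \<noteq> j"
      have "g i j + u = c + v" using fg[OF ij(2,1)] c ij by simp
      also have "\<dots> = g q p + u" using fg[OF pq(1,2)] c pq by simp
      finally show "g i j = g q p" by (rule add_right_imp_eq)
    qed
  qed blast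
  show ?thesis
  proof
    assume "\<exists>c. \<forall>i\<in>I. \<forall>j\<in>I. i \<noteq> j \<longrightarrow> f i j = c"
    then show "\<exists>c. \<forall>i\<in>I. \<forall>j\<in>I. i \<noteq> j \<longrightarrow> g i j = c" using const[of g u f v, OF fg] by blast
  next
    assume "\<exists>c. \<forall>i\<in>I. \<forall>j\<in>I. i \<noteq> j \<longrightarrow> g i j = c"
    then show "\<exists>c. \<forall>i\<in>I. \<forall>j\<in>I. i \<noteq> j \<longrightarrow> f i j = c" using const[of f v g u, OF fg[symmetric]] by blast
  qed
qed

lemma equichordal_complement:
  fixes W :: "nat \<Rightarrow> 'a::hermitian_scalar_field vec set"
  assumes W: "\<forall>i\<in>{1..n}. W i \<in> Gr k m"
  shows "equichordal k m n W \<longleftrightarrow> equichordal k (k - m) n (\<lambda>i. orth_compl k (W i))"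
  unfolding equichordal_def
  by (rule offdiagonal_constant_iff)
     (rule mat_trace_cross_gram_complement[OF bspec[OF W] bspec[OF W]])

lemma strongly_simplicial_complement:
  fixes W :: "nat \<Rightarrow> 'a::hermitian_scalar_field vec set"
  assumes W: "\<forall>i\<in>{1..n}. W i \<in> Gr k m"
  shows "strongly_simplicial k m n W \<longleftrightarrow> strongly_simplicial k (k - m) n (\<lambda>i. orth_compl k (W i))"
  unfolding strongly_simplicial_def
  by (rule offdiagonal_constant_iff)
     (rule proots_cross_gram_complement[OF bspec[OF W] bspec[OF W]])

lemma one_minus_eq_smult_iff:
  fixes A :: "'a::ring_1 mat"
  assumes A: "A \<in> carrier_mat m m"
  shows "1\<^sub>m m - A = a \<cdot>\<^sub>m 1\<^sub>m m \<longleftrightarrow> A = (1 - a) \<cdot>\<^sub>m 1\<^sub>m m"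
proof
  assume *: "1\<^sub>m m - A = a \<cdot>\<^sub>m 1\<^sub>m m"
  show "A = (1 - a) \<cdot>\<^sub>m 1\<^sub>m m"
  proof (rule eq_matI)
    fix i j assume "i < dim_row ((1 - a) \<cdot>\<^sub>m 1\<^sub>m m)" "j < dim_col ((1 - a) \<cdot>\<^sub>m 1\<^sub>m m)"
    then show "A $$ (i, j) = ((1 - a) \<cdot>\<^sub>m 1\<^sub>m m) $$ (i, j)"
      using arg_cong[OF *, of "\<lambda>X. X $$ (i, j)"] A by (auto simp: algebra_simps)
  qed (use A in auto)
qed (auto intro!: eq_matI)

text \<open>
  If the cross-Gramian is scalar, then so is \<open>B * mat_adjoint B\<close> for the matrix \<open>B\<close> shared with the
  complements. Then \<open>mat_adjoint B * B\<close> can be scalar only if \<open>B\<close> is square or zero, and it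
  is scalar in both of these cases.
\<close>

lemma scalar_cross_gram_complement:
  fixes W W' :: "'a::hermitian_scalar_field vec set"
  assumes m: "m \<le> k" and W: "W \<in> Gr k m" and W': "W' \<in> Gr k m"
    and a: "cross_gram k m W W' = a \<cdot>\<^sub>m 1\<^sub>m m"
  shows "cross_gram k (k - m) (orth_compl k W') (orth_compl k W) = b \<cdot>\<^sub>m 1\<^sub>m (k - m) \<Longrightarrow>
      k = 2 * m \<or> W \<subseteq> W'"
    and "k = 2 * m \<Longrightarrow>
      cross_gram k (k - m) (orth_compl k W') (orth_compl k W) = a \<cdot>\<^sub>m 1\<^sub>m (k - m)"
    and "W \<subseteq> W' \<Longrightarrow>
      cross_gram k (k - m) (orth_compl k W') (orth_compl k W) = 1 \<cdot>\<^sub>m 1\<^sub>m (k - m)"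
proof -
  obtain B where B: "B \<in> carrier_mat m (k - m)"
    and G: "cross_gram k m W W' = 1\<^sub>m m - B * mat_adjoint B"
    and G': "cross_gram k (k - m) (orth_compl k W') (orth_compl k W) = 1\<^sub>m (k - m) - mat_adjoint B * B"
    and B0: "B = 0\<^sub>m m (k - m) \<longleftrightarrow> W \<subseteq> W'"
    using cross_gram_complement[OF W W'] .
  note B' = mat_adjoint_carrier[OF B]
  note scalar = one_minus_eq_smult_iff[OF mult_carrier_mat[OF B B']]
  note scalar' = one_minus_eq_smult_iff[OF mult_carrier_mat[OF B' B]]
  have BB: "B * mat_adjoint B = (1 - a) \<cdot>\<^sub>m 1\<^sub>m m" using a unfolding G scalar .
  show "k = 2 * m \<or> W \<subseteq> W'"
    if "cross_gram k (k - m) (orth_compl k W') (orth_compl k W) = b \<cdot>\<^sub>m 1\<^sub>m (k - m)"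
  proof -
    have "mat_adjoint B * B = (1 - b) \<cdot>\<^sub>m 1\<^sub>m (k - m)" using that unfolding G' scalar' .
    then have "B = 0\<^sub>m m (k - m) \<or> m = k - m"
      by (rule scalar_grams_imp_zero_or_square[OF B BB])
    then show ?thesis using B0 m by auto
  qed
  show "cross_gram k (k - m) (orth_compl k W') (orth_compl k W) = a \<cdot>\<^sub>m 1\<^sub>m (k - m)" if "k = 2 * m"
  proof -
    have d: "k - m = m" using that by simp
    show ?thesis
      unfolding G' scalar' using square_scalar_gram_commute[OF _ BB] B unfolding d by blast
  qed
  show "cross_gram k (k - m) (orth_compl k W') (orth_compl k W) = 1 \<cdot>\<^sub>m 1\<^sub>m (k - m)" if "W \<subseteq> W'"
  proof -
    have "B = 0\<^sub>m m (k - m)" using that B0 by blast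
    then show ?thesis unfolding G' scalar' by (auto intro!: eq_matI simp: scalar_prod_def)
  qed
qed

text \<open>
  When \<open>k \<noteq> 2 * m\<close>, every member is contained in every other one, hence all are equal. In the converse
  direction the parameter is unchanged if \<open>k = 2 * m\<close>, and it is 1 if all subspaces coincide.
\<close>

lemma equiisoclinic_complement:
  fixes W :: "nat \<Rightarrow> 'a::hermitian_scalar_field vec set"
  assumes m: "m \<le> k" and W: "\<forall>i\<in>{1..n}. W i \<in> Gr k m" and ei: "equiisoclinic k m n W"
  shows "equiisoclinic k (k - m) n (\<lambda>i. orth_compl k (W i))
    \<longleftrightarrow> k = 2 * m \<or> (\<forall>i\<in>{1..n}. \<forall>j\<in>{1..n}. W i = W j)"
proof -
  obtain \<alpha> :: real where \<alpha>G: "0 \<le> \<alpha> \<and> (\<forall>i\<in>{1..n}. \<forall>j\<in>{1..n}. i \<noteq> j \<longrightarrow>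
      cross_gram k m (W i) (W j) = of_real \<alpha> \<cdot>\<^sub>m 1\<^sub>m m)"
    using ei unfolding equiisoclinic_def by (rule exE)
  note \<alpha> = conjunct1[OF \<alpha>G] and G = conjunct2[OF \<alpha>G]
  have pair: "W i \<in> Gr k m" "W j \<in> Gr k m" "cross_gram k m (W i) (W j) = of_real \<alpha> \<cdot>\<^sub>m 1\<^sub>m m"
    if "i \<in> {1..n}" "j \<in> {1..n}" "i \<noteq> j" for i j
    using bspec[OF W that(1)] bspec[OF W that(2)] bspec[OF bspec[OF G that(1)] that(2)] that(3) by simp_all
  show ?thesis
  proof
    assume "equiisoclinic k (k - m) n (\<lambda>i. orth_compl k (W i))"
    then obtain \<beta> :: real where \<beta>: "0 \<le> \<beta> \<and> (\<forall>i\<in>{1..n}. \<forall>j\<in>{1..n}. i \<noteq> j \<longrightarrow>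
        cross_gram k (k - m) (orth_compl k (W i)) (orth_compl k (W j)) = of_real \<beta> \<cdot>\<^sub>m 1\<^sub>m (k - m))"
      unfolding equiisoclinic_def by (rule exE)
    have "k = 2 * m \<or> W i \<subseteq> W j" if ij: "i \<in> {1..n}" "j \<in> {1..n}" for i j
    proof (cases "i = j")
      case False
      have "cross_gram k (k - m) (orth_compl k (W j)) (orth_compl k (W i)) = of_real \<beta> \<cdot>\<^sub>m 1\<^sub>m (k - m)"
        using bspec[OF bspec[OF conjunct2[OF \<beta>] ij(2)] ij(1)] False by simp
      then show ?thesis by (rule scalar_cross_gram_complement(1)[OF m pair[OF ij False]])
    qed simp
    then show "k = 2 * m \<or> (\<forall>i\<in>{1..n}. \<forall>j\<in>{1..n}. W i = W j)" by blast
  next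
    assume "k = 2 * m \<or> (\<forall>i\<in>{1..n}. \<forall>j\<in>{1..n}. W i = W j)"
    then show "equiisoclinic k (k - m) n (\<lambda>i. orth_compl k (W i))"
    proof
      assume k: "k = 2 * m"
      show ?thesis
        unfolding equiisoclinic_def
      proof (intro exI conjI ballI impI)
        show "0 \<le> \<alpha>" by (fact \<alpha>)
        fix i j assume ij: "i \<in> {1..n}" "j \<in> {1..n}" "i \<noteq> j"
        show "cross_gram k (k - m) (orth_compl k (W i)) (orth_compl k (W j)) = of_real \<alpha> \<cdot>\<^sub>m 1\<^sub>m (k - m)"
          by (rule scalar_cross_gram_complement(2)[OF m pair[OF ij(2,1) ij(3)[symmetric]] k])
      qed
    next
      assume same: "\<forall>i\<in>{1..n}. \<forall>j\<in>{1..n}. W i = W j"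
      show ?thesis
        unfolding equiisoclinic_def
      proof (intro exI conjI ballI impI)
        show "0 \<le> (1 :: real)" by simp
        fix i j assume ij: "i \<in> {1..n}" "j \<in> {1..n}" "i \<noteq> j"
        have "W j \<subseteq> W i" using same ij by blast
        then show "cross_gram k (k - m) (orth_compl k (W i)) (orth_compl k (W j)) = of_real 1 \<cdot>\<^sub>m 1\<^sub>m (k - m)"
          using scalar_cross_gram_complement(3)[OF m pair[OF ij(2,1) ij(3)[symmetric]]] by simp
      qed
    qed
  qed
qed

section \<open>Chordal distances and orthoplectic packings\<close>

lemma orth_proj_orth_compl:
  fixes W :: "'a::hermitian_scalar_field vec set"
  assumes "W \<in> Gr k m"
  shows "orth_proj k W \<in> carrier_mat k k" and "mat_trace (orth_proj k W) = of_nat m"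
    and "orth_proj k (orth_compl k W) = 1\<^sub>m k - orth_proj k W"
proof -
  note onb = Gr_onb_mat[OF assms]
  note L = is_onb_matD(1)[OF onb(1)] and LL = is_onb_matD(2)[OF onb(1)]
  show "orth_proj k W \<in> carrier_mat k k"
    unfolding orth_proj_eq[OF onb(1)] by (rule mult_carrier_mat[OF L mat_adjoint_carrier[OF L]])
  show "mat_trace (orth_proj k W) = of_nat m"
    unfolding orth_proj_eq[OF onb(1)] mat_trace_mult_comm[OF L mat_adjoint_carrier[OF L]] LL
    by (rule mat_trace_one)
  show "orth_proj k (orth_compl k W) = 1\<^sub>m k - orth_proj k W"
    unfolding orth_proj_eq[OF onb(1)] orth_proj_eq[OF onb(2)]
    by (rule complementary_onbs_proj[OF complementary_onbsI[OF onb]])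
qed

text \<open>
  From \<open>tr ((1 - P) (1 - Q)) = k - 2 m + tr (P Q)\<close> one gets
  \<open>(k - m) - tr ((1 - P) (1 - Q)) = m - tr (P Q)\<close>, so complementation is an isometry.
\<close>

lemma chordal_dist_orth_compl:
  fixes W W' :: "'a::hermitian_scalar_field vec set"
  assumes m: "m \<le> k" and W: "W \<in> Gr k m" and W': "W' \<in> Gr k m"
  shows "chordal_dist k (k - m) (orth_compl k W) (orth_compl k W') = chordal_dist k m W W'"
proof -
  define P Q where "P = orth_proj k W" and "Q = orth_proj k W'"
  note P = orth_proj_orth_compl[OF W, folded P_def] and Q = orth_proj_orth_compl[OF W', folded Q_def]
  have cQ: "1\<^sub>m k - Q \<in> carrier_mat k k" using Q(1) by (rule minus_carrier_mat)
  have "(1\<^sub>m k - P) * (1\<^sub>m k - Q) = (1\<^sub>m k - Q) - P * (1\<^sub>m k - Q)"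
    using minus_mult_distrib_mat[OF one_carrier_mat P(1) cQ] left_mult_one_mat[OF cQ] by simp
  also have "P * (1\<^sub>m k - Q) = P - P * Q"
    using mult_minus_distrib_mat[OF P(1) one_carrier_mat Q(1)] right_mult_one_mat[OF P(1)] by simp
  finally have "mat_trace ((1\<^sub>m k - P) * (1\<^sub>m k - Q))
      = (of_nat k - of_nat m) - (of_nat m - mat_trace (P * Q))"
    using mat_trace_minus[OF cQ, of "P - P * Q"] mat_trace_minus[OF one_carrier_mat Q(1)]
      mat_trace_minus[OF P(1), of "P * Q"] P Q
    by (simp add: mat_trace_one minus_carrier_mat)
  also have "\<dots> = of_real (real k - 2 * real m) + mat_trace (P * Q)" by simp
  finally have "real_part (mat_trace ((1\<^sub>m k - P) * (1\<^sub>m k - Q)))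
      = real k - 2 * real m + real_part (mat_trace (P * Q))"
    by (simp only: real_part_of_real_add)
  then show ?thesis
    unfolding chordal_dist_def P(3) Q(3) P_def[symmetric] Q_def[symmetric]
    using m by (simp add: of_nat_diff)
qed

text \<open>
  The distances agree, and the orthoplex bound \<open>m (k - m) / k\<close> is symmetric under
  exchanging \<open>m\<close> and \<open>k - m\<close>.
\<close>

lemma orthoplectic_packing_complement:
  fixes W :: "nat \<Rightarrow> 'a::hermitian_scalar_field vec set"
  assumes m: "m \<le> k" and W: "\<forall>i\<in>{1..n}. W i \<in> Gr k m"
  shows "orthoplectic_packing k m n W \<longleftrightarrow> orthoplectic_packing k (k - m) n (\<lambda>i. orth_compl k (W i))"
proof -
  have eq: "chordal_dist k (k - m) (orth_compl k (W i)) (orth_compl k (W j)) = chordal_dist k m (W i) (W j)"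
    if "i \<in> {1..n}" "j \<in> {1..n}" for i j
    by (rule chordal_dist_orth_compl[OF m bspec[OF W that(1)] bspec[OF W that(2)]])
  have "{(chordal_dist k (k - m) (orth_compl k (W i)) (orth_compl k (W j)))\<^sup>2 | i j.
        i \<in> {1..n} \<and> j \<in> {1..n} \<and> i \<noteq> j}
      = {(chordal_dist k m (W i) (W j))\<^sup>2 | i j. i \<in> {1..n} \<and> j \<in> {1..n} \<and> i \<noteq> j}"
    by (simp only: eq cong: rev_conj_cong)
  moreover have "real (k - m) * real (k - (k - m)) / real k = real m * real (k - m) / real k"
    using m by simp
  ultimately show ?thesis unfolding orthoplectic_packing_def by (simp only:)
qed

section \<open>Tight fusion frames\<close>

text \<open>
  The fusion frame operator as a matrix. It is written entrywise because matrices form an additive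
  monoid only once their size is fixed.
\<close>

definition proj_sum :: "nat \<Rightarrow> nat \<Rightarrow> (nat \<Rightarrow> 'a::conjugatable_field vec set) \<Rightarrow> 'a mat" where
  "proj_sum k n W = mat k k (\<lambda>(r, c). \<Sum>i=1..n. orth_proj k (W i) $$ (r, c))"

lemma finsum_orth_proj:
  fixes W :: "nat \<Rightarrow> 'a::conjugatable_field vec set"
  assumes P: "\<And>i. i \<in> {1..n} \<Longrightarrow> orth_proj k (W i) \<in> carrier_mat k k" and x: "x \<in> carrier_vec k"
  shows "finsum_vec TYPE('a) k (\<lambda>i. orth_proj k (W i) *\<^sub>v x) {1..n} = proj_sum k n W *\<^sub>v x"
proof (rule eq_vecI)
  have f: "(\<lambda>i. orth_proj k (W i) *\<^sub>v x) \<in> {1..n} \<rightarrow> carrier_vec k"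
    using mult_mat_vec_carrier[OF P x] by blast
  then have c: "finsum_vec TYPE('a) k (\<lambda>i. orth_proj k (W i) *\<^sub>v x) {1..n} \<in> carrier_vec k"
    by (rule finsum_vec_closed)
  then show "dim_vec (finsum_vec TYPE('a) k (\<lambda>i. orth_proj k (W i) *\<^sub>v x) {1..n}) = dim_vec (proj_sum k n W *\<^sub>v x)"
    by (simp add: proj_sum_def)
  fix r assume "r < dim_vec (proj_sum k n W *\<^sub>v x)"
  then have r: "r < k" by (simp add: proj_sum_def)
  have "finsum_vec TYPE('a) k (\<lambda>i. orth_proj k (W i) *\<^sub>v x) {1..n} $ r
      = (\<Sum>i=1..n. (orth_proj k (W i) *\<^sub>v x) $ r)"
    using index_finsum_vec[OF _ r f] by simp
  also have "\<dots> = (\<Sum>i=1..n. \<Sum>c<k. orth_proj k (W i) $$ (r, c) * x $ c)"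
  proof (rule sum.cong)
    fix i assume "i \<in> {1..n}"
    then have "orth_proj k (W i) \<in> carrier_mat k k" by (rule P)
    then show "(orth_proj k (W i) *\<^sub>v x) $ r = (\<Sum>c<k. orth_proj k (W i) $$ (r, c) * x $ c)"
      using x r by (auto simp: scalar_prod_def atLeast0LessThan)
  qed simp
  also have "\<dots> = (\<Sum>c<k. (\<Sum>i=1..n. orth_proj k (W i) $$ (r, c)) * x $ c)"
    by (subst sum.swap) (simp add: sum_distrib_right)
  also have "\<dots> = (proj_sum k n W *\<^sub>v x) $ r"
    using x r by (auto simp: proj_sum_def scalar_prod_def atLeast0LessThan)
  finally show "finsum_vec TYPE('a) k (\<lambda>i. orth_proj k (W i) *\<^sub>v x) {1..n} $ r = (proj_sum k n W *\<^sub>v x) $ r" .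
qed

lemma tight_fusion_frame_iff:
  fixes W :: "nat \<Rightarrow> 'a::real_or_complex vec set"
  assumes P: "\<And>i. i \<in> {1..n} \<Longrightarrow> orth_proj k (W i) \<in> carrier_mat k k"
  shows "tight_fusion_frame k n A W \<longleftrightarrow> A > 0 \<and> proj_sum k n W = of_real A \<cdot>\<^sub>m 1\<^sub>m k"
proof -
  have S: "proj_sum k n W \<in> carrier_mat k k" by (simp add: proj_sum_def)
  have scale: "x = of_real (1 / A) \<cdot>\<^sub>v y \<longleftrightarrow> y = of_real A \<cdot>\<^sub>v x" if "A > 0" for x y :: "'a vec"
    using that by (auto simp: smult_smult_assoc simp flip: of_real_mult)
  have one: "(of_real A \<cdot>\<^sub>m 1\<^sub>m k) *\<^sub>v x = of_real A \<cdot>\<^sub>v x" if "x \<in> carrier_vec k" for x :: "'a vec"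
    using that by (intro eq_vecI) auto
  have "(\<forall>x\<in>carrier_vec k. proj_sum k n W *\<^sub>v x = of_real A \<cdot>\<^sub>v x)
      \<longleftrightarrow> proj_sum k n W = of_real A \<cdot>\<^sub>m 1\<^sub>m k"
    using eq_mat_on_vecI[OF S smult_carrier_mat[OF one_carrier_mat], of "of_real A"] one by auto
  then show ?thesis
    unfolding tight_fusion_frame_def using finsum_orth_proj[OF P] scale by auto
qed

text \<open>
  Each projection has trace \<open>m\<close>. The relation \<open>n * m = A * k\<close> determines the frame bound, and this is
  what makes the positivity of \<open>A\<close> equivalent to that of \<open>n - A\<close>.
\<close>

lemma proj_sum_scalar_bound:
  fixes W :: "nat \<Rightarrow> 'a::hermitian_scalar_field vec set"
  assumes W: "\<forall>i\<in>{1..n}. W i \<in> Gr k m" and S: "proj_sum k n W = of_real A \<cdot>\<^sub>m 1\<^sub>m k"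
  shows "real n * real m = A * real k"
proof -
  note P = orth_proj_orth_compl(1,2)[OF bspec[OF W]]
  have "mat_trace (proj_sum k n W) = (\<Sum>r<k. \<Sum>i=1..n. orth_proj k (W i) $$ (r, r))"
    by (simp add: proj_sum_def mat_trace_def)
  also have "\<dots> = (\<Sum>i=1..n. \<Sum>r<k. orth_proj k (W i) $$ (r, r))" by (rule sum.swap)
  also have "\<dots> = (\<Sum>i=1..n. mat_trace (orth_proj k (W i)))"
  proof (rule sum.cong)
    fix i assume "i \<in> {1..n}"
    then have "dim_row (orth_proj k (W i)) = k" using P(1) by blast
    then show "(\<Sum>r<k. orth_proj k (W i) $$ (r, r)) = mat_trace (orth_proj k (W i))"
      by (simp add: mat_trace_def)
  qed simp
  also have "\<dots> = of_nat n * of_nat m" using P(2) by simp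
  finally have "of_real (real n * real m) = (of_real (A * real k) :: 'a)"
    unfolding S by (simp add: mat_trace_smult[of _ k] mat_trace_one)
  then show ?thesis by (simp only: of_real_eq_iff)
qed

lemma proj_sum_orth_compl:
  fixes W :: "nat \<Rightarrow> 'a::hermitian_scalar_field vec set"
  assumes W: "\<forall>i\<in>{1..n}. W i \<in> Gr k m"
  shows "proj_sum k n (\<lambda>i. orth_compl k (W i)) = of_nat n \<cdot>\<^sub>m 1\<^sub>m k - proj_sum k n W"
proof -
  note P = orth_proj_orth_compl[OF bspec[OF W]]
  have "orth_proj k (orth_compl k (W i)) $$ (r, c) = 1\<^sub>m k $$ (r, c) - orth_proj k (W i) $$ (r, c)"
    if "i \<in> {1..n}" "r < k" "c < k" for i r c
    using P(1)[OF that(1)] that by (simp add: P(3))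
  then show ?thesis
    by (intro eq_matI) (auto simp: proj_sum_def sum_subtractf)
qed

text \<open>
  The frame operators of the two collections add up to \<open>n\<close> times the identity, so one is \<open>A\<close> times the
  identity if and only if the other is \<open>n - A\<close> times the identity. The two positivity conditions on
  the bounds then agree because \<open>A = n m / k\<close> and \<open>n - A = n (k - m) / k\<close> with \<open>0 < m < k\<close>: both
  are positive unless \<open>n = 0\<close>.
\<close>

lemma tight_fusion_frame_complement:
  fixes W :: "nat \<Rightarrow> 'a::hermitian_scalar_field vec set"
  assumes m: "1 \<le> m" "m < k" and W: "\<forall>i\<in>{1..n}. W i \<in> Gr k m"
  shows "tight_fusion_frame k n A W \<longleftrightarrow>
    tight_fusion_frame k n (real n - A) (\<lambda>i. orth_compl k (W i))"
proof -
  note P = orth_proj_orth_compl[OF bspec[OF W]]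
  have P': "orth_proj k (orth_compl k (W i)) \<in> carrier_mat k k" if "i \<in> {1..n}" for i
    unfolding P(3)[OF that] using P(1)[OF that] by (rule minus_carrier_mat)
  have S: "proj_sum k n W \<in> carrier_mat k k" by (simp add: proj_sum_def)
  have "proj_sum k n W = of_real A \<cdot>\<^sub>m 1\<^sub>m k
      \<longleftrightarrow> of_nat n \<cdot>\<^sub>m 1\<^sub>m k - proj_sum k n W = of_real (real n - A) \<cdot>\<^sub>m 1\<^sub>m k"
    (is "?L \<longleftrightarrow> ?R")
  proof
    assume ?L then show ?R by (simp only:) (rule eq_matI; simp add: algebra_simps)
  next
    assume R: ?R
    show ?L
    proof (rule eq_matI)
      fix r c assume "r < dim_row (of_real A \<cdot>\<^sub>m 1\<^sub>m k :: 'a mat)" "c < dim_col (of_real A \<cdot>\<^sub>m 1\<^sub>m k :: 'a mat)"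
      then show "proj_sum k n W $$ (r, c) = (of_real A \<cdot>\<^sub>m 1\<^sub>m k) $$ (r, c)"
        using arg_cong[OF R, of "\<lambda>X. X $$ (r, c)"] S by (auto simp: algebra_simps)
    qed (use S in auto)
  qed
  moreover have "A > 0 \<longleftrightarrow> real n - A > 0" if "proj_sum k n W = of_real A \<cdot>\<^sub>m 1\<^sub>m k"
  proof -
    have bound: "real n * real m = A * real k" by (rule proj_sum_scalar_bound[OF W that])
    have "A = real n * real m / real k" using bound m by (simp add: field_simps)
    moreover have "real n - A = real n * (real k - real m) / real k"
      using bound m by (simp add: field_simps)
    ultimately show ?thesis using m by (auto simp: zero_less_divide_iff zero_less_mult_iff)
  qed
  moreover have "tight_fusion_frame k n A W \<longleftrightarrow> A > 0 \<and> proj_sum k n W = of_real A \<cdot>\<^sub>m 1\<^sub>m k"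
    by (rule tight_fusion_frame_iff[OF P(1)])
  moreover have "tight_fusion_frame k n (real n - A) (\<lambda>i. orth_compl k (W i)) \<longleftrightarrow>
      real n - A > 0 \<and> of_nat n \<cdot>\<^sub>m 1\<^sub>m k - proj_sum k n W = of_real (real n - A) \<cdot>\<^sub>m 1\<^sub>m k"
    unfolding proj_sum_orth_compl[OF W, symmetric] by (rule tight_fusion_frame_iff[OF P'])
  ultimately show ?thesis by blast
qed

section \<open>The five equivalences\<close>

lemma complement_equivalences:
  fixes W :: "nat \<Rightarrow> 'a::hermitian_scalar_field vec set"
  assumes "1 \<le> m" "m < k" and "\<forall>i\<in>{1..n}. W i \<in> Gr k m"
  shows "(\<forall>A. tight_fusion_frame k n A W \<longleftrightarrow>
          tight_fusion_frame k n (real n - A) (\<lambda>i. orth_compl k (W i))) \<and>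
       (equichordal k m n W \<longleftrightarrow>
          equichordal k (k - m) n (\<lambda>i. orth_compl k (W i))) \<and>
       (strongly_simplicial k m n W \<longleftrightarrow>
          strongly_simplicial k (k - m) n (\<lambda>i. orth_compl k (W i))) \<and>
       (equiisoclinic k m n W \<longrightarrow>
          (equiisoclinic k (k - m) n (\<lambda>i. orth_compl k (W i)) \<longleftrightarrow>
             k = 2 * m \<or> (\<forall>i\<in>{1..n}. \<forall>j\<in>{1..n}. W i = W j))) \<and>
       (orthoplectic_packing k m n W \<longleftrightarrow>
          orthoplectic_packing k (k - m) n (\<lambda>i. orth_compl k (W i)))"
proof (intro conjI allI impI)
  fix A
  show "tight_fusion_frame k n A W \<longleftrightarrow>
      tight_fusion_frame k n (real n - A) (\<lambda>i. orth_compl k (W i))"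
    by (rule tight_fusion_frame_complement[OF assms])
qed (rule equichordal_complement[OF assms(3)] strongly_simplicial_complement[OF assms(3)]
    equiisoclinic_complement[OF less_imp_le[OF assms(2)] assms(3)]
    orthoplectic_packing_complement[OF less_imp_le[OF assms(2)] assms(3)]; assumption?)+

theorem proposition2p5:
  fixes k m n :: nat
  assumes "1 \<le> m" and "m \<le> k - 1"
  shows
    "(\<forall>W :: nat \<Rightarrow> real vec set. (\<forall>i\<in>{1..n}. W i \<in> Gr k m) \<longrightarrow>
       (\<forall>A::real. tight_fusion_frame k n A W \<longleftrightarrow>
          tight_fusion_frame k n (real n - A) (\<lambda>i. orth_compl k (W i))) \<and>
       (equichordal k m n W \<longleftrightarrow>
          equichordal k (k - m) n (\<lambda>i. orth_compl k (W i))) \<and>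
       (strongly_simplicial k m n W \<longleftrightarrow>
          strongly_simplicial k (k - m) n (\<lambda>i. orth_compl k (W i))) \<and>
       (equiisoclinic k m n W \<longrightarrow>
          (equiisoclinic k (k - m) n (\<lambda>i. orth_compl k (W i)) \<longleftrightarrow>
             k = 2 * m \<or> (\<forall>i\<in>{1..n}. \<forall>j\<in>{1..n}. W i = W j))) \<and>
       (orthoplectic_packing k m n W \<longleftrightarrow>
          orthoplectic_packing k (k - m) n (\<lambda>i. orth_compl k (W i))))
     \<and>
     (\<forall>W :: nat \<Rightarrow> complex vec set. (\<forall>i\<in>{1..n}. W i \<in> Gr k m) \<longrightarrow>
       (\<forall>A::real. tight_fusion_frame k n A W \<longleftrightarrow>
          tight_fusion_frame k n (real n - A) (\<lambda>i. orth_compl k (W i))) \<and>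
       (equichordal k m n W \<longleftrightarrow>
          equichordal k (k - m) n (\<lambda>i. orth_compl k (W i))) \<and>
       (strongly_simplicial k m n W \<longleftrightarrow>
          strongly_simplicial k (k - m) n (\<lambda>i. orth_compl k (W i))) \<and>
       (equiisoclinic k m n W \<longrightarrow>
          (equiisoclinic k (k - m) n (\<lambda>i. orth_compl k (W i)) \<longleftrightarrow>
             k = 2 * m \<or> (\<forall>i\<in>{1..n}. \<forall>j\<in>{1..n}. W i = W j))) \<and>
       (orthoplectic_packing k m n W \<longleftrightarrow>
          orthoplectic_packing k (k - m) n (\<lambda>i. orth_compl k (W i))))"
proof -
  have m: "m < k" using assms by simp
  show ?thesis
    by (rule conjI; intro allI impI; rule complement_equivalences[OF assms(1) m]; assumption)
qed

end
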